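(* From the dynamical point of view, the multiple chordal $\mathrm{SLE}(0)$ systems (with common capacity parametrization) are described by functions $U_j$, $j=1,\dots,n$, through $$\dot x_j=U_j(\boldsymbol{x})+\sum_{k\neq j}\frac{2}{x_j-x_k},$$ where the $U_j$ satisfy the quadratic null vector equations $$\frac12U_j^2+\sum_{k\neq j}\frac{2}{x_k-x_j}U_k-\sum_{k\neq j}\frac{6}{(x_j-x_k)^2}=0,\qquad j=1,\dots,n .$$ (i) The multiple chordal $\mathrm{SLE}(0)$ system is transformed into a Calogero–Moser system by introducing the momentum functions $$p_j=U_j+\sum_{k\neq j}\frac{2}{x_j-x_k}.$$ Then the $p_j$ satisfy the null vector Hamiltonian equations $$\mathcal{H}_j(\boldsymbol{x},\boldsymbol{p})=\frac12p_j^2-\sum_{k\neq j}(p_j+p_k)f_{jk}+\sum_k\sum_{l\neq k}f_{jk}f_{jl}-2\sum_{k\neq j}f_{jk}^2=0 .$$ The sum of the null vector Hamiltonians $\mathcal{H}_j$ is exactly the classical Calogero–Moser Hamiltonian: $$\mathcal{H}=\sum_j\mathcal{H}_j=\sum_j\frac{p_j^2}{2}-\sum_{1\le j<k\le n}\frac{8}{(x_j-x_k)^2}=0 .$$ (ii) The commutation relations of different pairs of growth points are interpreted in terms of the Poisson bracket: $$\{\mathcal{H}_j,\mathcal{H}_k\}=f_{jk}^2\,(\mathcal{H}_k-\mathcal{H}_j),\qquad j\neq k .$$ Thus the vector flows $X_{\mathcal{H}_j}$ induced by the Hamiltonians $\mathcal{H}_j$ commute along the submanifolds $$N_c=\{(\boldsymbol{x},\boldsymbol{p}):\mathcal{H}_j(\boldsymbol{x},\boldsymbol{p})=c\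 \text{for all } j\},\qquad c\in\mathbb{R}.$$
   Context: Here $\boldsymbol{x}=(x_1,\dots,x_n)$ are the growth points, with $x_1<\dots<x_n$ real, each $U_j$ is a smooth real-valued function of $\boldsymbol{x}$ on this chamber, and $\boldsymbol{p}=(p_1,\dots,p_n)$. Common capacity parametrization means that the Loewner flow is $\partial_t g_t(z)=\sum_{j=1}^n\frac{2}{g_t(z)-x_j(t)}$, $g_0(z)=z$, i.e. all $n$ curves grow simultaneously with rate $\nu_j(t)=1$. Set $f_{jk}=f_{jk}(\boldsymbol{x})=\frac{2}{x_j-x_k}$ for $j\neq k$ and $f_{jj}=0$; sums over $k,l$ run over $\{1,\dots,n\}$ subject to the indicated restrictions. For a smooth function $F(\boldsymbol{x},\boldsymbol{p})$ on phase space, the associated vector field is $$X_F=\sum_{j=1}^n\frac{\partial F}{\partial p_j}\partial_{x_j}-\sum_{j=1}^n\frac{\partial F}{\partial x_j}\partial_{p_j},$$ and the Poisson bracket of smooth $F,G$ is $$\{F,G\}=\sum_{j=1}^n\Big(\frac{\partial F}{\partial p_j}\frac{\partial G}{\partial x_j}-\frac{\partial F}{\partial x_j}\frac{\partial G}{\partial p_j}\Big),$$ so that $[X_F,X_G]=X_{\{F,G\}}$.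
   Formalization: The constant 8 in the Calogero–Moser Hamiltonian is corrected to 16; "the flows commute along N_c", false as a vanishing Lie bracket, becomes: on N_c, {H_j,H_k}=0 and [X_{H_j},X_{H_k}]=f_jk^2(X_{H_k}-X_{H_j}), and N_c is invariant under each flow. *)

theory Defs
  imports "HOL-Analysis.Analysis"
begin

text \<open>The index type \<open>'n\<close> stands for \<open>{1..n}\<close>, hence \<open>{finite, linorder}\<close>. Several functions
  below are total only because division by zero is; they are meant for configurations in the
  chamber.\<close>

definition chamber :: "(real ^ 'n::{finite,linorder}) set" where
  "chamber = {x. \<forall>i j. i < j \<longrightarrow> x $ i < x $ j}"

type_synonym 'n phase = "(real ^ 'n) \<times> (real ^ 'n)"

definition phase_space :: "'n::{finite,linorder} phase set" where
  "phase_space = chamber \<times> UNIV"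


primrec Ck_on :: "nat \<Rightarrow> (real ^ 'n::finite) set \<Rightarrow> (real ^ 'n \<Rightarrow> real) \<Rightarrow> bool" where
  "Ck_on 0 S f \<longleftrightarrow> continuous_on S f"
| "Ck_on (Suc k) S f \<longleftrightarrow>
     (\<forall>x\<in>S. f differentiable (at x)) \<and>
     (\<forall>i. Ck_on k S (\<lambda>x. frechet_derivative f (at x) (axis i 1)))"

text \<open>Meant for open \<open>S\<close> only, because derivatives are taken at \<open>x\<close> and not within \<open>S\<close>.\<close>
definition smooth_on :: "(real ^ 'n::finite) set \<Rightarrow> (real ^ 'n \<Rightarrow> real) \<Rightarrow> bool" where
  "smooth_on S f \<longleftrightarrow> (\<forall>k. Ck_on k S f)"


definition partial_x :: "('n::finite phase \<Rightarrow> real) \<Rightarrow> 'n \<Rightarrow> 'n phase \<Rightarrow> real" where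
  "partial_x F j y = frechet_derivative F (at y) (axis j 1, 0)"

definition partial_p :: "('n::finite phase \<Rightarrow> real) \<Rightarrow> 'n \<Rightarrow> 'n phase \<Rightarrow> real" where
  "partial_p F j y = frechet_derivative F (at y) (0, axis j 1)"

definition ham_field :: "('n::finite phase \<Rightarrow> real) \<Rightarrow> 'n phase \<Rightarrow> 'n phase" where
  "ham_field F y = ((\<chi> j. partial_p F j y), (\<chi> j. - partial_x F j y))"

definition poisson :: "('n::finite phase \<Rightarrow> real) \<Rightarrow> ('n phase \<Rightarrow> real) \<Rightarrow> 'n phase \<Rightarrow> real" where
  "poisson F G y = (\<Sum>j\<in>UNIV. partial_p F j y * partial_x G j y - partial_x F j y * partial_p G j y)"

text \<open>Sign convention: as derivations \<open>[X, Y] = X Y - Y X\<close>, so that the bracket of the Hamiltonian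
  fields of \<open>F\<close> and \<open>G\<close> is the Hamiltonian field of \<open>poisson F G\<close>.\<close>
definition lie_bracket ::
    "('a::real_normed_vector \<Rightarrow> 'a) \<Rightarrow> ('a \<Rightarrow> 'a) \<Rightarrow> 'a \<Rightarrow> 'a" where
  "lie_bracket X Y y = frechet_derivative Y (at y) (X y) - frechet_derivative X (at y) (Y y)"

definition integral_curve ::
    "('a::real_normed_vector \<Rightarrow> 'a) \<Rightarrow> real set \<Rightarrow> (real \<Rightarrow> 'a) \<Rightarrow> bool" where
  "integral_curve X I \<gamma> \<longleftrightarrow> (\<forall>t\<in>I. (\<gamma> has_vector_derivative X (\<gamma> t)) (at t within I))"


definition fcoef :: "real ^ 'n \<Rightarrow> 'n \<Rightarrow> 'n \<Rightarrow> real" where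
  "fcoef x j k = (if j = k then 0 else 2 / (x $ j - x $ k))"

definition null_vector_eqs :: "('n::{finite,linorder} \<Rightarrow> (real, 'n) vec \<Rightarrow> real) \<Rightarrow> bool" where
  "null_vector_eqs U \<longleftrightarrow> (\<forall>x\<in>chamber. \<forall>j.
     1 / 2 * (U j x)\<^sup>2 + (\<Sum>k\<in>UNIV - {j}. 2 / (x $ k - x $ j) * U k x)
       - (\<Sum>k\<in>UNIV - {j}. 6 / (x $ j - x $ k)\<^sup>2) = 0)"

definition sle0_field :: "('n::finite \<Rightarrow> real ^ 'n \<Rightarrow> real) \<Rightarrow> real ^ 'n \<Rightarrow> real ^ 'n" where
  "sle0_field U x = (\<chi> j. U j x + (\<Sum>k\<in>UNIV - {j}. 2 / (x $ j - x $ k)))"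

definition momentum :: "('n::finite \<Rightarrow> real ^ 'n \<Rightarrow> real) \<Rightarrow> real ^ 'n \<Rightarrow> real ^ 'n" where
  "momentum U x = (\<chi> j. U j x + (\<Sum>k\<in>UNIV - {j}. 2 / (x $ j - x $ k)))"

definition nv_ham :: "'n::finite \<Rightarrow> 'n phase \<Rightarrow> real" where
  "nv_ham j = (\<lambda>(x, p).
     1 / 2 * (p $ j)\<^sup>2
     - (\<Sum>k\<in>UNIV - {j}. (p $ j + p $ k) * fcoef x j k)
     + (\<Sum>k\<in>UNIV. \<Sum>l\<in>UNIV - {k}. fcoef x j k * fcoef x j l)
     - 2 * (\<Sum>k\<in>UNIV - {j}. (fcoef x j k)\<^sup>2))"

text \<open>With the normalization \<open>f\<^sub>j\<^sub>k = 2 / (x\<^sub>j - x\<^sub>k)\<close> the constant \<open>8\<close> belongs to the sum over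
  ordered pairs \<open>j \<noteq> k\<close>; over pairs \<open>j < k\<close>, as here, it is \<open>16\<close>.\<close>
definition cm_ham :: "'n::{finite,linorder} phase \<Rightarrow> real" where
  "cm_ham = (\<lambda>(x, p).
     (\<Sum>j\<in>UNIV. (p $ j)\<^sup>2 / 2) - (\<Sum>j\<in>UNIV. \<Sum>k\<in>{k. j < k}. 16 / (x $ j - x $ k)\<^sup>2))"

definition level_set :: "real \<Rightarrow> 'n::{finite,linorder} phase set" where
  "level_set c = {y \<in> phase_space. \<forall>j. nv_ham j y = c}"

end

theory Submission
  imports Defs
begin

text \<open>
  With \<open>F j\<close> the sum of the \<open>f\<^sub>j\<^sub>k\<close> over \<open>k\<close>, put \<open>r j = (F j - U j) / 4\<close>. The null vector
  equations become \<open>(r j)\<^sup>2 = (\<Sum>k\<noteq>j. (r j - r k) / (x j - x k))\<close>, which says that the Fuchsian equation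
  \<open>y'' - (W' / W) y' + (\<Sum>j. r j / (X - x j)) y = 0\<close> with \<open>W = (\<Prod>j. X - x j)\<close> has trivial projective monodromy.
  Its solutions are the polynomials \<open>y\<close> with \<open>y' = r j y\<close> at every \<open>x j\<close>: such a \<open>y\<close> of degree at most
  \<open>n + 1\<close> is mapped by the operator to a polynomial of degree less than \<open>n\<close> vanishing at all nodes, and
  counting dimensions provides two of them.

  Newton's equations for the Calogero-Moser potential along \<open>x' = p\<close> amount to
  \<open>r j' = (\<Sum>k. f\<^sub>j\<^sub>k\<^sup>2 (r j - r k))\<close>. The difference \<open>e\<close> of the two sides lies in the kernel of the linearized
  equations. This kernel may be nonzero a priori, because the null vector equations may have multiple
  roots, so implicit differentiation alone does not give \<open>e = 0\<close>. Instead \<open>e\<close> is paired with the cross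
  Wronskian of fundamental systems at \<open>x\<close> and at a point with one coordinate shifted: the residue
  theorem makes the pairing vanish, while its first order term in the shift of \<open>x k\<close> is a nonzero multiple
  of \<open>e k\<close>.

  The Poisson bracket relation reduces to \<open>f\<^sub>j\<^sub>k f\<^sub>j\<^sub>l - f\<^sub>j\<^sub>k f\<^sub>k\<^sub>l + f\<^sub>j\<^sub>l f\<^sub>k\<^sub>l = 0\<close>, and invariance of the level
  sets to uniqueness for the linear equation satisfied by \<open>\<H>\<^sub>k - c\<close> along the flow of \<open>\<H>\<^sub>j\<close>.
\<close>

section \<open>Null vector and Calogero-Moser Hamiltonians\<close>

text \<open>For distinct coordinates this is the ratio \<open>W'' / W'\<close> at
  \<open>x $ j\<close>, where \<open>W\<close> is the monic polynomial whose roots are the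
  coordinates of \<open>x\<close>.\<close>

definition pole_sum :: "real ^ 'n::finite \<Rightarrow> 'n \<Rightarrow> real" where
  "pole_sum x j = (\<Sum>k\<in>UNIV. fcoef x j k)"

lemma chamber_distinct: "x \<in> chamber \<Longrightarrow> i \<noteq> j \<Longrightarrow> x $ i \<noteq> x $ j"
  by (cases i j rule: linorder_cases) (force simp: chamber_def)+

lemma fcoef_refl [simp]: "fcoef x j j = 0"
  by (simp add: fcoef_def)

lemma fcoef_antisym: "fcoef x k j = - fcoef x j k"
  by (auto simp: fcoef_def minus_divide_right)

text \<open>With \<open>u = x $ j - x $ k\<close> and \<open>v = x $ k - x $ l\<close> this is the
  partial fraction identity \<open>1 / (u v) = (1 / u + 1 / v) / (u + v)\<close>. Every cancellation
  over triples of distinct indices below rests on it.\<close>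

lemma fcoef_triple:
  assumes "x \<in> chamber" "j \<noteq> k" "j \<noteq> l" "k \<noteq> l"
  shows "fcoef x j k * fcoef x j l - fcoef x j k * fcoef x k l + fcoef x j l * fcoef x k l = 0"
proof -
  have "x $ j \<noteq> x $ k" "x $ j \<noteq> x $ l" "x $ k \<noteq> x $ l"
    using assms chamber_distinct by blast+
  then show ?thesis
    using assms by (simp add: fcoef_def divide_simps)
qed

lemma open_chamber: "open (chamber :: (real ^ 'n::{finite,linorder}) set)"
proof -
  have eq: "(chamber :: (real, 'n) vec set) = (\<Inter>i. \<Inter>j\<in>{j. i < j}. {x. x $ i < x $ j})"
    by (auto simp: chamber_def)
  show ?thesis
    unfolding eq by (intro open_INT finite ballI open_Collect_less continuous_intros)
qed

lemma open_phase_space: "open (phase_space :: 'n::{finite,linorder} phase set)"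
  by (simp add: phase_space_def open_Times open_chamber)

section \<open>Rearrangement of sums over the index type\<close>

lemma sum_Diff_refl:
  fixes g :: "'n::finite \<Rightarrow> real"
  shows "g j = 0 \<Longrightarrow> (\<Sum>k\<in>UNIV - {j}. g k) = (\<Sum>k\<in>UNIV. g k)"
  by (simp add: sum_diff1)

lemma sum_UNIV_two:
  fixes g :: "'n::finite \<Rightarrow> real"
  assumes "j \<noteq> k"
  shows "(\<Sum>l\<in>UNIV. g l) = g j + g k + (\<Sum>l\<in>UNIV - {j, k}. g l)"
proof -
  have "(\<Sum>l\<in>UNIV. g l) = g j + (\<Sum>l\<in>UNIV - {j}. g l)"
    by (simp add: sum.remove)
  also have "(\<Sum>l\<in>UNIV - {j}. g l) = g k + (\<Sum>l\<in>UNIV - {j} - {k}. g l)"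
    using assms by (intro sum.remove) auto
  also have "UNIV - {j} - {k} = UNIV - {j, k}"
    by auto
  finally show ?thesis
    by simp
qed

lemma sum_antisym_zero:
  fixes t :: "'a \<Rightarrow> 'a \<Rightarrow> real"
  assumes "\<And>k l. k \<in> A \<Longrightarrow> l \<in> A \<Longrightarrow> t k l + t l k = 0"
  shows "(\<Sum>k\<in>A. \<Sum>l\<in>A. t k l) = 0"
proof -
  have "(\<Sum>k\<in>A. \<Sum>l\<in>A. t k l) = (\<Sum>k\<in>A. \<Sum>l\<in>A. t l k)"
    by (rule sum.swap)
  moreover have "(\<Sum>k\<in>A. \<Sum>l\<in>A. t k l) + (\<Sum>k\<in>A. \<Sum>l\<in>A. t l k) = 0"
    using assms by (simp flip: sum.distrib)
  ultimately show ?thesis by simp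
qed

lemma sum_distinct_antisym_zero:
  fixes t :: "'n::finite \<Rightarrow> 'n \<Rightarrow> real"
  assumes "\<And>k l. k \<noteq> j \<Longrightarrow> l \<noteq> j \<Longrightarrow> k \<noteq> l \<Longrightarrow> t k l + t l k = 0"
  shows "(\<Sum>k\<in>UNIV - {j}. \<Sum>l\<in>UNIV - {j, k}. t k l) = 0"
proof -
  \<comment> \<open>Padding with zeros on the diagonal makes the inner range independent of
    \<open>k\<close>, as \<open>sum_antisym_zero\<close> requires.\<close>
  have "(\<Sum>k\<in>UNIV - {j}. \<Sum>l\<in>UNIV - {j, k}. t k l)
      = (\<Sum>k\<in>UNIV - {j}. \<Sum>l\<in>UNIV - {j}. if k = l then 0 else t k l)"
    by (intro sum.cong refl sum.mono_neutral_cong_left) auto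
  also have "\<dots> = 0"
    using assms by (intro sum_antisym_zero) auto
  finally show ?thesis .
qed

lemma sum_fcoef_diff:
  assumes "j \<noteq> k"
  shows "pole_sum x j - pole_sum x k
    = 2 * fcoef x j k + (\<Sum>l\<in>UNIV - {j, k}. fcoef x j l - fcoef x k l)"
  unfolding pole_sum_def sum_subtractf[symmetric]
  by (subst sum_UNIV_two[OF assms]) (simp add: fcoef_antisym[of x k j])

text \<open>The double sum is the square of the pole sum minus the sum of squares, which turns the
  coefficient 2 of the last sum into 3. As \<open>fcoef x j j = 0\<close>, all sums may run over the
  whole index type.\<close>

lemma nv_ham_alt:
  "nv_ham j y = 1 / 2 * (snd y $ j)\<^sup>2 - (\<Sum>k\<in>UNIV. (snd y $ j + snd y $ k) * fcoef (fst y) j k)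
     + (pole_sum (fst y) j)\<^sup>2 - 3 * (\<Sum>k\<in>UNIV. (fcoef (fst y) j k)\<^sup>2)"
proof -
  define x p where "x = fst y" and "p = snd y"
  have y: "y = (x, p)" by (simp add: x_def p_def)
  have "(\<Sum>l\<in>UNIV - {k}. fcoef x j k * fcoef x j l) = fcoef x j k * pole_sum x j - (fcoef x j k)\<^sup>2" for k
    by (simp add: sum_diff1 power2_eq_square pole_sum_def right_diff_distrib flip: sum_distrib_left)
  then have "(\<Sum>k\<in>UNIV. \<Sum>l\<in>UNIV - {k}. fcoef x j k * fcoef x j l)
      = (\<Sum>k\<in>UNIV. fcoef x j k * pole_sum x j) - (\<Sum>k\<in>UNIV. (fcoef x j k)\<^sup>2)"
    by (simp only: sum_subtractf)
  also have "(\<Sum>k\<in>UNIV. fcoef x j k * pole_sum x j) = (\<Sum>k\<in>UNIV. fcoef x j k) * pole_sum x j"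
    by (rule sum_distrib_right[symmetric])
  also have "\<dots> = (pole_sum x j)\<^sup>2"
    by (simp only: power2_eq_square pole_sum_def)
  finally have 1: "(\<Sum>k\<in>UNIV. \<Sum>l\<in>UNIV - {k}. fcoef x j k * fcoef x j l)
      = (pole_sum x j)\<^sup>2 - (\<Sum>k\<in>UNIV. (fcoef x j k)\<^sup>2)" .
  have 2: "(\<Sum>k\<in>UNIV - {j}. (p $ j + p $ k) * fcoef x j k) = (\<Sum>k\<in>UNIV. (p $ j + p $ k) * fcoef x j k)"
    by (rule sum_Diff_refl) simp
  have 3: "(\<Sum>k\<in>UNIV - {j}. (fcoef x j k)\<^sup>2) = (\<Sum>k\<in>UNIV. (fcoef x j k)\<^sup>2)"
    by (rule sum_Diff_refl) simp
  show ?thesis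
    unfolding nv_ham_def y case_prod_conv fst_conv snd_conv 1 2 3 by simp
qed

section \<open>First and second differentials of the null vector Hamiltonians\<close>

lemma has_derivative_fcoef:
  assumes g: "(g has_derivative g') (at y within S)" and "g y \<in> chamber"
  shows "((\<lambda>y. fcoef (g y) j k) has_derivative
      (\<lambda>u. - (fcoef (g y) j k)\<^sup>2 / 2 * (g' u $ j - g' u $ k))) (at y within S)"
proof (cases "j = k")
  case False
  then have ne: "g y $ j - g y $ k \<noteq> 0"
    using chamber_distinct[OF assms(2)] by simp
  have "((\<lambda>y. g y $ i) has_derivative (\<lambda>u. g' u $ i)) (at y within S)" for i
    using bounded_linear.has_derivative[OF bounded_linear_vec_nth g] .
  then have "((\<lambda>y. g y $ j - g y $ k) has_derivative (\<lambda>u. g' u $ j - g' u $ k)) (at y within S)"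
    by (intro has_derivative_diff)
  from has_derivative_divide[OF has_derivative_const this ne]
  have "((\<lambda>y. 2 / (g y $ j - g y $ k)) has_derivative
      (\<lambda>u. - (2 / (g y $ j - g y $ k))\<^sup>2 / 2 * (g' u $ j - g' u $ k))) (at y within S)"
  proof (rule has_derivative_eq_rhs)
    have "- 2 * (inverse d * e * inverse d) + 0 / d = - (2 / d)\<^sup>2 / 2 * e" for d e :: real
      by (simp add: power2_eq_square inverse_eq_divide)
    then show "(\<lambda>u. - 2 * (inverse (g y $ j - g y $ k) * (g' u $ j - g' u $ k) * inverse (g y $ j - g y $ k))
        + 0 / (g y $ j - g y $ k)) = (\<lambda>u. - (2 / (g y $ j - g y $ k))\<^sup>2 / 2 * (g' u $ j - g' u $ k))"
      by blast
  qed
  with False show ?thesis by (simp add: fcoef_def)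
qed simp

lemmas has_derivative_fst_nth = bounded_linear.has_derivative
  [OF bounded_linear_compose[OF bounded_linear_vec_nth bounded_linear_fst]]
lemmas has_derivative_snd_nth = bounded_linear.has_derivative
  [OF bounded_linear_compose[OF bounded_linear_vec_nth bounded_linear_snd]]

lemma has_derivative_phase_components [derivative_intros]:
  "((\<lambda>y :: 'n::{finite,linorder} phase. fst y $ i) has_derivative (\<lambda>u. fst u $ i)) (at y within S)"
  "((\<lambda>y :: 'n phase. snd y $ i) has_derivative (\<lambda>u. snd u $ i)) (at y within S)"
  using has_derivative_fst_nth[OF has_derivative_ident] has_derivative_snd_nth[OF has_derivative_ident]
  by auto

lemma has_derivative_fcoef_phase [derivative_intros]:
  fixes y :: "'n::{finite,linorder} phase"
  assumes "y \<in> phase_space"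
  shows "((\<lambda>y. fcoef (fst y) j k) has_derivative
      (\<lambda>u. - (fcoef (fst y) j k)\<^sup>2 / 2 * (fst u $ j - fst u $ k))) (at y within S)"
  using assms
  by (intro has_derivative_fcoef bounded_linear_imp_has_derivative bounded_linear_fst)
    (auto simp: phase_space_def)

definition nv_grad :: "'n::{finite,linorder} \<Rightarrow> 'n phase \<Rightarrow> 'n phase \<Rightarrow> real" where
  "nv_grad j y u = snd y $ j * snd u $ j
     - (\<Sum>k\<in>UNIV. (snd u $ j + snd u $ k) * fcoef (fst y) j k)
     + (\<Sum>k\<in>UNIV. (snd y $ j + snd y $ k) * (fcoef (fst y) j k)\<^sup>2 / 2 * (fst u $ j - fst u $ k))
     - (\<Sum>k\<in>UNIV. fcoef (fst y) j k) * (\<Sum>k\<in>UNIV. (fcoef (fst y) j k)\<^sup>2 * (fst u $ j - fst u $ k))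
     + 3 * (\<Sum>k\<in>UNIV. (fcoef (fst y) j k) ^ 3 * (fst u $ j - fst u $ k))"

text \<open>The second differential of \<open>nv_ham j\<close>, with \<open>v\<close> the direction
  in which \<open>nv_grad j y u\<close> is differentiated. It is written out so that its symmetry,
  on which the bracket of Hamiltonian fields depends, can be read off.\<close>

definition nv_hess :: "'n::{finite,linorder} \<Rightarrow> 'n phase \<Rightarrow> 'n phase \<Rightarrow> 'n phase \<Rightarrow> real" where
  "nv_hess j y v u = snd v $ j * snd u $ j
     + (\<Sum>k\<in>UNIV. (snd u $ j + snd u $ k) * (fcoef (fst y) j k)\<^sup>2 / 2 * (fst v $ j - fst v $ k))
     + (\<Sum>k\<in>UNIV. (snd v $ j + snd v $ k) * (fcoef (fst y) j k)\<^sup>2 / 2 * (fst u $ j - fst u $ k))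
     - (\<Sum>k\<in>UNIV. (snd y $ j + snd y $ k) * (fcoef (fst y) j k) ^ 3 / 2 *
          ((fst u $ j - fst u $ k) * (fst v $ j - fst v $ k)))
     + (\<Sum>k\<in>UNIV. (fcoef (fst y) j k)\<^sup>2 * (fst v $ j - fst v $ k)) *
       (\<Sum>k\<in>UNIV. (fcoef (fst y) j k)\<^sup>2 * (fst u $ j - fst u $ k)) / 2
     + (\<Sum>k\<in>UNIV. fcoef (fst y) j k) *
       (\<Sum>k\<in>UNIV. (fcoef (fst y) j k) ^ 3 * ((fst u $ j - fst u $ k) * (fst v $ j - fst v $ k)))
     - 9 / 2 * (\<Sum>k\<in>UNIV. (fcoef (fst y) j k) ^ 4 * ((fst u $ j - fst u $ k) * (fst v $ j - fst v $ k)))"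

lemma nv_hess_sym: "nv_hess j y u v = nv_hess j y v u"
  unfolding nv_hess_def by (simp add: ac_simps)

text \<open>All follow from \<open>f' = - f^2 / 2 * d'\<close> for \<open>f = 2 / d\<close>. The
  first three are the sums in \<open>nv_ham\<close>; those with the constants \<open>c\<close>,
  \<open>d\<close>, \<open>e\<close> serve \<open>nv_grad\<close>, where the first direction
  \<open>u\<close> is frozen.\<close>

lemma has_derivative_fcoef_sums:
  assumes "y \<in> phase_space"
  shows
  "((\<lambda>y. \<Sum>k\<in>UNIV. (snd y $ j + snd y $ k) * fcoef (fst y) j k) has_derivative
      (\<lambda>u. (\<Sum>k\<in>UNIV. (snd u $ j + snd u $ k) * fcoef (fst y) j k)
        - (\<Sum>k\<in>UNIV. (snd y $ j + snd y $ k) * (fcoef (fst y) j k)\<^sup>2 / 2 * (fst u $ j - fst u $ k)))) (at y)"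
  "((\<lambda>y. \<Sum>k\<in>UNIV. fcoef (fst y) j k) has_derivative
      (\<lambda>u. - (\<Sum>k\<in>UNIV. (fcoef (fst y) j k)\<^sup>2 * (fst u $ j - fst u $ k)) / 2)) (at y)"
  "((\<lambda>y. \<Sum>k\<in>UNIV. (fcoef (fst y) j k)\<^sup>2) has_derivative
      (\<lambda>u. - (\<Sum>k\<in>UNIV. (fcoef (fst y) j k) ^ 3 * (fst u $ j - fst u $ k)))) (at y)"
  "((\<lambda>y. \<Sum>k\<in>UNIV. (c + d k) * fcoef (fst y) j k) has_derivative
      (\<lambda>v. - (\<Sum>k\<in>UNIV. (c + d k) * (fcoef (fst y) j k)\<^sup>2 / 2 * (fst v $ j - fst v $ k)))) (at y)"
  "((\<lambda>y. \<Sum>k\<in>UNIV. (snd y $ j + snd y $ k) * (fcoef (fst y) j k)\<^sup>2 / 2 * e k)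
      has_derivative (\<lambda>v. (\<Sum>k\<in>UNIV. (snd v $ j + snd v $ k) * (fcoef (fst y) j k)\<^sup>2 / 2 * e k)
         - (\<Sum>k\<in>UNIV. (snd y $ j + snd y $ k) * fcoef (fst y) j k ^ 3 / 2 *
          (e k * (fst v $ j - fst v $ k))))) (at y)"
  "((\<lambda>y. \<Sum>k\<in>UNIV. (fcoef (fst y) j k)\<^sup>2 * e k) has_derivative
      (\<lambda>v. - (\<Sum>k\<in>UNIV. fcoef (fst y) j k ^ 3 * (e k * (fst v $ j - fst v $ k))))) (at y)"
  "((\<lambda>y. \<Sum>k\<in>UNIV. fcoef (fst y) j k ^ 3 * e k) has_derivative
      (\<lambda>v. - (3 * (\<Sum>k\<in>UNIV. fcoef (fst y) j k ^ 4 * (e k * (fst v $ j - fst v $ k)))) / 2)) (at y)"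
  by ((rule derivative_eq_intros assms refl zero_neq_numeral[symmetric])+,
      (intro ext, simp only: sum_negf[symmetric] sum_subtractf[symmetric] sum_divide_distrib sum_distrib_left,
      intro sum.cong refl, simp add: eval_nat_numeral field_simps))+

lemma has_derivative_nv_ham:
  assumes "y \<in> phase_space"
  shows "(nv_ham j has_derivative nv_grad j y) (at y)"
  unfolding nv_ham_alt[abs_def] pole_sum_def
  by (rule derivative_eq_intros has_derivative_fcoef_sums[OF assms] refl)+
    (simp add: fun_eq_iff nv_grad_def)

lemma has_derivative_nv_grad:
  assumes "y \<in> phase_space"
  shows "((\<lambda>y. nv_grad j y u) has_derivative (\<lambda>v. nv_hess j y v u)) (at y)"
  unfolding nv_grad_def
  by (rule derivative_eq_intros has_derivative_fcoef_sums[OF assms] refl)+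
    (simp add: fun_eq_iff nv_hess_def)

section \<open>Hamiltonian vector fields and Poisson brackets\<close>

lemma phase_expand:
  fixes u :: "'n::finite phase"
  shows "u = (\<Sum>l\<in>UNIV. fst u $ l *\<^sub>R (axis l 1, 0)) + (\<Sum>l\<in>UNIV. snd u $ l *\<^sub>R (0, axis l 1))"
proof -
  have "(\<Sum>l\<in>UNIV. z $ l *\<^sub>R axis l 1) = z" for z :: "(real, 'n) vec"
    using basis_expansion[of z] by (simp add: scalar_mult_eq_scaleR)
  then show ?thesis
    by (intro prod_eqI) (simp_all add: fst_sum snd_sum)
qed

lemma linear_phase_expand:
  fixes u :: "'n::finite phase"
  assumes "linear D"
  shows "D u = (\<Sum>l\<in>UNIV. fst u $ l *\<^sub>R D (axis l 1, 0)) + (\<Sum>l\<in>UNIV. snd u $ l *\<^sub>R D (0, axis l 1))"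
  by (subst phase_expand[of u])
    (simp only: linear_add[OF assms] linear_sum[OF assms] linear_scale[OF assms] o_def)

lemma partial_eq:
  assumes "(F has_derivative D) (at y)"
  shows "partial_x F j y = D (axis j 1, 0)" "partial_p F j y = D (0, axis j 1)"
  using frechet_derivative_at[OF assms] by (simp_all add: partial_x_def partial_p_def)

lemma ham_field_eq:
  assumes "(F has_derivative D) (at y)"
  shows "ham_field F y = ((\<chi> j. D (0, axis j 1)), (\<chi> j. - D (axis j 1, 0)))"
  by (simp add: ham_field_def partial_eq[OF assms])

text \<open>Expanding a differential along the coordinate directions turns the coordinate sum into a
  derivative along a Hamiltonian field. In this form the bracket is a rate of change along a
  flow.\<close>

lemma poisson_eq:
  fixes F G :: "'n::finite phase \<Rightarrow> real"
  assumes F: "(F has_derivative DF) (at y)" and G: "(G has_derivative DG) (at y)"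
  shows "poisson F G y = DG (ham_field F y)" "poisson F G y = - DF (ham_field G y)"
proof -
  have lin: "linear DF" "linear DG"
    using F G has_derivative_linear by blast+
  show "poisson F G y = DG (ham_field F y)"
    unfolding poisson_def partial_eq[OF F] partial_eq[OF G] linear_phase_expand[OF lin(2), of "ham_field F y"]
    unfolding ham_field_eq[OF F] by (simp add: sum_subtractf sum_negf mult.commute)
  show "poisson F G y = - DF (ham_field G y)"
    unfolding poisson_def partial_eq[OF F] partial_eq[OF G] linear_phase_expand[OF lin(1), of "ham_field G y"]
    unfolding ham_field_eq[OF G] by (simp add: sum_subtractf sum_negf mult.commute)
qed

lemma has_derivative_vec_lambda:
  fixes f :: "'a::real_normed_vector \<Rightarrow> 'n::finite \<Rightarrow> real"
  assumes "\<And>i. ((\<lambda>x. f x i) has_derivative (\<lambda>v. f' v i)) (at y)"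
  shows "((\<lambda>x. \<chi> i. f x i) has_derivative (\<lambda>v. \<chi> i. f' v i)) (at y)"
  using assms by (subst has_derivative_componentwise_within) (auto simp: Basis_vec_def inner_axis)

lemma has_derivative_ham_field:
  fixes F :: "'n::finite phase \<Rightarrow> real"
  assumes "open S" "y \<in> S"
    and F: "\<And>z. z \<in> S \<Longrightarrow> (F has_derivative DF z) (at z)"
    and DF: "\<And>u. ((\<lambda>z. DF z u) has_derivative (\<lambda>v. HF v u)) (at y)"
  shows "(ham_field F has_derivative (\<lambda>v. ((\<chi> j. HF v (0, axis j 1)), (\<chi> j. - HF v (axis j 1, 0))))) (at y)"
proof -
  have "((\<lambda>z. ((\<chi> j. DF z (0, axis j 1)), (\<chi> j. - DF z (axis j 1, 0)))) has_derivative
      (\<lambda>v. ((\<chi> j. HF v (0, axis j 1)), (\<chi> j. - HF v (axis j 1, 0))))) (at y)"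
    by (intro has_derivative_Pair has_derivative_vec_lambda has_derivative_minus DF)
  then show ?thesis
    by (rule has_derivative_transform_within_open[OF _ assms(1,2)]) (simp add: ham_field_eq[OF F])
qed

text \<open>By the product rule the bracket has differential \<open>HG v X - HF v Y\<close> in
  direction \<open>v\<close>, where \<open>X\<close> and \<open>Y\<close> are the fields of
  \<open>F\<close> and \<open>G\<close> at \<open>y\<close>. Symmetry of the second differentials
  lets the coordinate directions in place of \<open>v\<close> change places with \<open>X\<close>
  and \<open>Y\<close>, which gives the components of the derivative of one field along the
  other.\<close>

lemma lie_bracket_ham_field:
  fixes F G :: "'n::finite phase \<Rightarrow> real"
  assumes "open S" "y \<in> S"
    and F: "\<And>z. z \<in> S \<Longrightarrow> (F has_derivative DF z) (at z)"
    and G: "\<And>z. z \<in> S \<Longrightarrow> (G has_derivative DG z) (at z)"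
    and DF: "\<And>u. ((\<lambda>z. DF z u) has_derivative (\<lambda>v. HF v u)) (at y)"
    and DG: "\<And>u. ((\<lambda>z. DG z u) has_derivative (\<lambda>v. HG v u)) (at y)"
    and sym: "\<And>u v. HF u v = HF v u" "\<And>u v. HG u v = HG v u"
  shows "lie_bracket (ham_field F) (ham_field G) y = ham_field (poisson F G) y"
proof -
  have Fy: "(F has_derivative DF y) (at y)" and Gy: "(G has_derivative DG y) (at y)"
    using F G assms(2) by auto
  have lin: "linear (HF u)" "linear (HG u)" for u
    using DF[of u] DG[of u] unfolding sym[of _ u] by (auto dest: has_derivative_linear)
  have "((\<lambda>z. \<Sum>j\<in>UNIV. DF z (0, axis j 1) * DG z (axis j 1, 0) - DF z (axis j 1, 0) * DG z (0, axis j 1))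
      has_derivative (\<lambda>v. HG v (ham_field F y) - HF v (ham_field G y))) (at y)"
  proof (rule has_derivative_eq_rhs)
    show "((\<lambda>z. \<Sum>j\<in>UNIV. DF z (0, axis j 1) * DG z (axis j 1, 0) - DF z (axis j 1, 0) * DG z (0, axis j 1))
      has_derivative (\<lambda>v. \<Sum>j\<in>UNIV.
        (DF y (0, axis j 1) * HG v (axis j 1, 0) + HF v (0, axis j 1) * DG y (axis j 1, 0))
        - (DF y (axis j 1, 0) * HG v (0, axis j 1) + HF v (axis j 1, 0) * DG y (0, axis j 1)))) (at y)"
      by (intro has_derivative_sum has_derivative_diff has_derivative_mult DF DG)
    show "(\<lambda>v. \<Sum>j\<in>UNIV.
        (DF y (0, axis j 1) * HG v (axis j 1, 0) + HF v (0, axis j 1) * DG y (axis j 1, 0))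
        - (DF y (axis j 1, 0) * HG v (0, axis j 1) + HF v (axis j 1, 0) * DG y (0, axis j 1)))
      = (\<lambda>v. HG v (ham_field F y) - HF v (ham_field G y))"
    proof
      fix v
      show "(\<Sum>j\<in>UNIV.
        (DF y (0, axis j 1) * HG v (axis j 1, 0) + HF v (0, axis j 1) * DG y (axis j 1, 0))
        - (DF y (axis j 1, 0) * HG v (0, axis j 1) + HF v (axis j 1, 0) * DG y (0, axis j 1)))
      = HG v (ham_field F y) - HF v (ham_field G y)"
        unfolding linear_phase_expand[OF lin(1)[of v], of "ham_field G y"]
          linear_phase_expand[OF lin(2)[of v], of "ham_field F y"]
        unfolding ham_field_eq[OF Fy] ham_field_eq[OF Gy]
        by (simp add: sum.distrib sum_subtractf sum_negf mult.commute)
    qed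
  qed
  then have P: "(poisson F G has_derivative (\<lambda>v. HG v (ham_field F y) - HF v (ham_field G y))) (at y)"
    by (rule has_derivative_transform_within_open[OF _ assms(1,2)])
      (simp add: poisson_def partial_eq[OF F] partial_eq[OF G])
  have "frechet_derivative (ham_field F) (at y)
      = (\<lambda>v. ((\<chi> j. HF v (0, axis j 1)), (\<chi> j. - HF v (axis j 1, 0))))"
    by (rule frechet_derivative_at[symmetric, OF has_derivative_ham_field[OF assms(1,2) F DF]])
  moreover have "frechet_derivative (ham_field G) (at y)
      = (\<lambda>v. ((\<chi> j. HG v (0, axis j 1)), (\<chi> j. - HG v (axis j 1, 0))))"
    by (rule frechet_derivative_at[symmetric, OF has_derivative_ham_field[OF assms(1,2) G DG]])
  ultimately show ?thesis
    unfolding lie_bracket_def ham_field_eq[OF P]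
    by (simp add: sym[of _ "(axis _ 1, 0)"] sym[of _ "(0, axis _ 1)"] vec_eq_iff)
qed

section \<open>Pole sum identities and the sum of the null vector Hamiltonians\<close>

lemma sum_pairs_split:
  fixes h :: "'n::finite \<Rightarrow> 'n \<Rightarrow> real"
  assumes "\<And>l. h j l = 0"
  shows "(\<Sum>k\<in>UNIV. \<Sum>l\<in>UNIV. h k l)
    = (\<Sum>k\<in>UNIV - {j}. h k j + h k k) + (\<Sum>k\<in>UNIV - {j}. \<Sum>l\<in>UNIV - {j, k}. h k l)"
proof -
  have "(\<Sum>k\<in>UNIV. \<Sum>l\<in>UNIV. h k l) = (\<Sum>k\<in>UNIV - {j}. \<Sum>l\<in>UNIV. h k l)"
    using assms by (intro sum_Diff_refl[symmetric]) simp
  also have "\<dots> = (\<Sum>k\<in>UNIV - {j}. h k j + h k k + (\<Sum>l\<in>UNIV - {j, k}. h k l))"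
    by (intro sum.cong refl sum_UNIV_two) auto
  finally show ?thesis
    by (simp add: sum.distrib)
qed

text \<open>Terms with \<open>j\<close>, \<open>k\<close>, \<open>l\<close> distinct cancel under
  exchange of \<open>k\<close> and \<open>l\<close> by \<open>fcoef_triple\<close>. What survives is
  \<open>l = j\<close>, contributing \<open>- f^2\<close>, and \<open>l = k\<close>, contributing
  \<open>- f^2 / 2\<close>; hence the factor 3/2.\<close>

lemma sum_fcoef_pole_sum:
  assumes "x \<in> chamber"
  shows "(\<Sum>k\<in>UNIV. fcoef x j k * pole_sum x k)
    = (pole_sum x j)\<^sup>2 / 2 - 3 / 2 * (\<Sum>k\<in>UNIV. (fcoef x j k)\<^sup>2)"
proof -
  let ?t = "\<lambda>k l. fcoef x j k * fcoef x k l - fcoef x j k * fcoef x j l / 2"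
  have "(\<Sum>k\<in>UNIV. fcoef x j k * pole_sum x k) - (pole_sum x j)\<^sup>2 / 2 = (\<Sum>k\<in>UNIV. \<Sum>l\<in>UNIV. ?t k l)"
    by (simp add: pole_sum_def power2_eq_square sum_subtractf sum_product
        flip: sum_distrib_left sum_divide_distrib)
  also have "\<dots> = (\<Sum>k\<in>UNIV - {j}. ?t k j + ?t k k) + (\<Sum>k\<in>UNIV - {j}. \<Sum>l\<in>UNIV - {j, k}. ?t k l)"
    by (rule sum_pairs_split) simp
  also have "(\<Sum>k\<in>UNIV - {j}. \<Sum>l\<in>UNIV - {j, k}. ?t k l) = 0"
  proof (rule sum_distinct_antisym_zero)
    fix k l assume "k \<noteq> j" "l \<noteq> j" "k \<noteq> l"
    then show "?t k l + ?t l k = 0"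
      using fcoef_triple[OF assms, of j k l] fcoef_antisym[of x l k] by (simp add: algebra_simps)
  qed
  also have "(\<Sum>k\<in>UNIV - {j}. ?t k j + ?t k k) + 0 = (\<Sum>k\<in>UNIV - {j}. - 3 / 2 * (fcoef x j k)\<^sup>2)"
    unfolding add_0_right by (intro sum.cong refl) (simp add: fcoef_antisym[of x _ j] power2_eq_square)
  also have "\<dots> = - 3 / 2 * (\<Sum>k\<in>UNIV. (fcoef x j k)\<^sup>2)"
    by (subst sum_Diff_refl) (simp_all add: sum_distrib_left)
  finally show ?thesis by simp
qed

lemma sum_fcoef_left: "(\<Sum>j\<in>UNIV. fcoef x j k) = - pole_sum x k"
  unfolding pole_sum_def sum_negf[symmetric] by (intro sum.cong refl fcoef_antisym)

text \<open>Sum \<open>sum_fcoef_pole_sum\<close> over \<open>j\<close>. By antisymmetry the left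
  side becomes minus the sum of squared pole sums, and the resulting linear equation is solved for
  that sum.\<close>

lemma sum_pole_sum_square:
  assumes "x \<in> chamber"
  shows "(\<Sum>j\<in>UNIV. (pole_sum x j)\<^sup>2) = (\<Sum>j\<in>UNIV. \<Sum>k\<in>UNIV. (fcoef x j k)\<^sup>2)"
proof -
  have "(\<Sum>j\<in>UNIV. \<Sum>k\<in>UNIV. fcoef x j k * pole_sum x k)
      = (\<Sum>k\<in>UNIV. (\<Sum>j\<in>UNIV. fcoef x j k) * pole_sum x k)"
    by (subst sum.swap) (simp add: sum_distrib_right)
  also have "\<dots> = - (\<Sum>k\<in>UNIV. (pole_sum x k)\<^sup>2)"
    by (simp add: sum_fcoef_left power2_eq_square sum_negf)
  finally have "- (\<Sum>k\<in>UNIV. (pole_sum x k)\<^sup>2)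
      = (\<Sum>j\<in>UNIV. (pole_sum x j)\<^sup>2) / 2 - 3 / 2 * (\<Sum>j\<in>UNIV. \<Sum>k\<in>UNIV. (fcoef x j k)\<^sup>2)"
    by (simp add: sum_fcoef_pole_sum[OF assms] sum_subtractf sum_negf sum_distrib_left sum_divide_distrib)
  then show ?thesis by simp
qed

lemma sum_sym_pairs:
  fixes g :: "'n::{finite,linorder} \<Rightarrow> 'n \<Rightarrow> real"
  assumes "\<And>j k. g j k = g k j" "\<And>j. g j j = 0"
  shows "(\<Sum>j\<in>UNIV. \<Sum>k\<in>UNIV. g j k) = 2 * (\<Sum>j\<in>UNIV. \<Sum>k\<in>{k. j < k}. g j k)"
proof -
  have "(\<Sum>k\<in>UNIV. g j k) = (\<Sum>k\<in>{k. j < k}. g j k) + (\<Sum>k\<in>{k. k < j}. g j k)" for j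
  proof -
    have "(\<Sum>k\<in>UNIV. g j k) = (\<Sum>k\<in>{k. j < k} \<union> {k. k < j}. g j k)"
      using assms(2) by (intro sum.mono_neutral_right) (auto simp: not_less_iff_gr_or_eq)
    also have "\<dots> = (\<Sum>k\<in>{k. j < k}. g j k) + (\<Sum>k\<in>{k. k < j}. g j k)"
      by (rule sum.union_disjoint) auto
    finally show ?thesis .
  qed
  moreover have "(\<Sum>j\<in>UNIV. \<Sum>k\<in>{k. k < j}. g j k) = (\<Sum>k\<in>UNIV. \<Sum>j\<in>{j. k < j}. g j k)"
    using sum.swap_restrict[of UNIV UNIV g "\<lambda>j k. k < j"] by simp
  ultimately show ?thesis
    using assms(1) by (simp add: sum.distrib)
qed

lemma fcoef_square_sym: "(fcoef x k j)\<^sup>2 = (fcoef x j k)\<^sup>2"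
  by (subst fcoef_antisym) simp

text \<open>Here \<open>16 / d^2 = 4 f^2\<close>, and summing over ordered instead of unordered
  pairs halves the 4.\<close>

lemma cm_ham_alt:
  assumes "fst y \<in> chamber"
  shows "cm_ham y = (\<Sum>j\<in>UNIV. 1 / 2 * (snd y $ j)\<^sup>2) - 2 * (\<Sum>j\<in>UNIV. \<Sum>k\<in>UNIV. (fcoef (fst y) j k)\<^sup>2)"
proof -
  have "(\<Sum>j\<in>UNIV. \<Sum>k\<in>{k. j < k}. 16 / (fst y $ j - fst y $ k)\<^sup>2)
      = 4 * (\<Sum>j\<in>UNIV. \<Sum>k\<in>{k. j < k}. (fcoef (fst y) j k)\<^sup>2)"
    unfolding sum_distrib_left by (intro sum.cong refl) (auto simp: fcoef_def power_divide)
  also have "2 * \<dots> = 4 * (\<Sum>j\<in>UNIV. \<Sum>k\<in>UNIV. (fcoef (fst y) j k)\<^sup>2)"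
    using sum_sym_pairs[of "\<lambda>j k. (fcoef (fst y) j k)\<^sup>2", OF fcoef_square_sym] by simp
  finally show ?thesis
    by (simp add: cm_ham_def case_prod_beta)
qed

text \<open>The terms linear in the momenta cancel by antisymmetry, and
  \<open>sum_pole_sum_square\<close> removes the three-body part: one copy of the sum of squares
  minus three leaves the factor -2.\<close>

lemma sum_nv_ham:
  assumes "y \<in> phase_space"
  shows "(\<Sum>j\<in>UNIV. nv_ham j y) = cm_ham y"
proof -
  define x p where "x = fst y" and "p = snd y"
  have x: "x \<in> chamber" using assms by (auto simp: phase_space_def x_def)
  have "(\<Sum>j\<in>UNIV. \<Sum>k\<in>UNIV. (p $ j + p $ k) * fcoef x j k) = 0"
  proof (rule sum_antisym_zero)
    show "(p $ k + p $ l) * fcoef x k l + (p $ l + p $ k) * fcoef x l k = 0" for k l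
      by (subst fcoef_antisym) (simp add: algebra_simps)
  qed
  then show ?thesis
    using sum_pole_sum_square[OF x]
    unfolding cm_ham_alt[OF x[unfolded x_def]] nv_ham_alt x_def[symmetric] p_def[symmetric]
    by (simp add: sum.distrib sum_subtractf flip: sum_distrib_left)
qed

section \<open>Brackets and flows of the null vector Hamiltonians\<close>

lemma sum_axis: "(\<Sum>k\<in>UNIV. axis l (1::real) $ k * h k) = h l"
proof -
  have "axis l (1::real) $ k * h k = (if k = l then h k else 0)" for k
    by (simp add: axis_def)
  then show ?thesis by simp
qed

text \<open>Each pair occurs in both orders and the cube is odd, so the two contributions to the
  force agree. In terms of distances the force is the sum of
  \<open>- 32 / (x l - x k)^3\<close>.\<close>

lemma ham_field_cm_ham:
  fixes y :: "'n::{finite,linorder} phase"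
  assumes "y \<in> phase_space"
  shows "ham_field cm_ham y = (snd y, \<chi> l. - 4 * (\<Sum>k\<in>UNIV. fcoef (fst y) l k ^ 3))"
proof -
  let ?D = "\<lambda>u :: 'n phase. (\<Sum>j\<in>UNIV. snd y $ j * snd u $ j)
    + 2 * (\<Sum>j\<in>UNIV. \<Sum>k\<in>UNIV. fcoef (fst y) j k ^ 3 * (fst u $ j - fst u $ k))"
  have "((\<lambda>y. (\<Sum>j\<in>UNIV. 1 / 2 * (snd y $ j)\<^sup>2)
      - 2 * (\<Sum>j\<in>UNIV. \<Sum>k\<in>UNIV. (fcoef (fst y) j k)\<^sup>2)) has_derivative ?D) (at y)"
    by (rule derivative_eq_intros has_derivative_fcoef_sums(3)[OF assms] refl)+
      (simp add: fun_eq_iff sum_negf mult.commute)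
  then have "(cm_ham has_derivative ?D) (at y)"
    by (rule has_derivative_transform_within_open[OF _ open_phase_space assms])
      (auto simp: phase_space_def cm_ham_alt)
  note eq = ham_field_eq[OF this]
  have "(\<Sum>j\<in>UNIV. \<Sum>k\<in>UNIV. fcoef (fst y) j k ^ 3 * (axis l 1 $ j - axis l 1 $ k))
      = 2 * (\<Sum>k\<in>UNIV. fcoef (fst y) l k ^ 3)" for l
  proof -
    have "(\<Sum>j\<in>UNIV. \<Sum>k\<in>UNIV. fcoef (fst y) j k ^ 3 * axis l 1 $ j)
        = (\<Sum>k\<in>UNIV. fcoef (fst y) l k ^ 3)"
      by (subst sum.swap) (simp add: mult.commute[of _ "axis _ _ $ _"] sum_axis)
    moreover have "(\<Sum>j\<in>UNIV. \<Sum>k\<in>UNIV. fcoef (fst y) j k ^ 3 * axis l 1 $ k)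
        = (\<Sum>k\<in>UNIV. fcoef (fst y) k l ^ 3)"
      by (simp add: mult.commute[of _ "axis _ _ $ _"] sum_axis)
    moreover have "(\<Sum>k\<in>UNIV. fcoef (fst y) k l ^ 3) = - (\<Sum>k\<in>UNIV. fcoef (fst y) l k ^ 3)"
      unfolding sum_negf[symmetric]
      by (intro sum.cong refl) (subst fcoef_antisym, simp)
    ultimately show ?thesis
      by (simp add: right_diff_distrib sum_subtractf)
  qed
  then show ?thesis
    unfolding eq by (simp add: vec_eq_iff mult.commute[of _ "axis _ _ $ _"] sum_axis prod_eq_iff)
qed

text \<open>For \<open>k \<noteq> j\<close> this is the partial derivative of
  \<open>nv_ham j\<close> with respect to the coordinate \<open>x k\<close>. The derivative in
  \<open>x j\<close> is minus the sum of these, because only differences of coordinates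
  occur.\<close>

definition nv_coupling :: "'n::{finite,linorder} phase \<Rightarrow> 'n \<Rightarrow> 'n \<Rightarrow> real" where
  "nv_coupling y j k = (fcoef (fst y) j k)\<^sup>2 / 2 *
     (2 * pole_sum (fst y) j - (snd y $ j + snd y $ k) - 6 * fcoef (fst y) j k)"

lemma nv_grad_alt:
  "nv_grad j y u = snd u $ j * (snd y $ j - pole_sum (fst y) j)
     - (\<Sum>k\<in>UNIV. snd u $ k * fcoef (fst y) j k)
     - (\<Sum>k\<in>UNIV. nv_coupling y j k * (fst u $ j - fst u $ k))"
proof -
  have "(\<Sum>k\<in>UNIV. nv_coupling y j k * (fst u $ j - fst u $ k))
      = pole_sum (fst y) j * (\<Sum>k\<in>UNIV. (fcoef (fst y) j k)\<^sup>2 * (fst u $ j - fst u $ k))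
      - (\<Sum>k\<in>UNIV. (snd y $ j + snd y $ k) * (fcoef (fst y) j k)\<^sup>2 / 2 * (fst u $ j - fst u $ k))
      - 3 * (\<Sum>k\<in>UNIV. fcoef (fst y) j k ^ 3 * (fst u $ j - fst u $ k))"
    unfolding sum_distrib_left sum_subtractf[symmetric]
    by (intro sum.cong refl) (simp add: nv_coupling_def power2_eq_square power3_eq_cube field_simps)
  moreover have "(\<Sum>k\<in>UNIV. (snd u $ j + snd u $ k) * fcoef (fst y) j k)
      = snd u $ j * pole_sum (fst y) j + (\<Sum>k\<in>UNIV. snd u $ k * fcoef (fst y) j k)"
    by (simp add: pole_sum_def distrib_right sum.distrib sum_distrib_left)
  ultimately show ?thesis
    unfolding nv_grad_def pole_sum_def[symmetric] by (simp add: right_diff_distrib mult.commute)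
qed

lemma partial_p_nv_ham:
  assumes "y \<in> phase_space"
  shows "partial_p (nv_ham j) l y
    = (if l = j then snd y $ j - pole_sum (fst y) j else 0) - fcoef (fst y) j l"
  unfolding partial_eq(2)[OF has_derivative_nv_ham[OF assms]] nv_grad_alt
  by (simp add: sum_axis) (simp add: axis_def)

text \<open>Since \<open>nv_ham k\<close> is invariant under translation of \<open>x\<close>, only
  the differences of the \<open>partial_p (nv_ham j)\<close> from their value at \<open>k\<close>
  enter. The index \<open>j\<close> is split off because \<open>p j\<close> appears only
  there.\<close>

lemma sum_partial_x_nv_ham:
  assumes "y \<in> phase_space" "j \<noteq> k"
  shows "(\<Sum>l\<in>UNIV. partial_p (nv_ham j) l y * partial_x (nv_ham k) l y)
    = nv_coupling y k j * (snd y $ j - pole_sum (fst y) j + fcoef (fst y) j k)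
      + (\<Sum>l\<in>UNIV - {j, k}. nv_coupling y k l * (fcoef (fst y) j k - fcoef (fst y) j l))"
proof -
  let ?a = "\<chi> l. partial_p (nv_ham j) l y"
  have D: "(nv_ham k has_derivative nv_grad k y) (at y)"
    by (rule has_derivative_nv_ham[OF assms(1)])
  have "(\<Sum>l\<in>UNIV. partial_p (nv_ham j) l y * partial_x (nv_ham k) l y) = nv_grad k y (?a, 0)"
    unfolding linear_phase_expand[OF has_derivative_linear[OF D], of "(?a, 0)"]
    by (simp add: partial_eq(1)[OF D])
  also have "\<dots> = (\<Sum>l\<in>UNIV. nv_coupling y k l * (?a $ l - ?a $ k))"
    unfolding nv_grad_alt by (simp add: sum_negf[symmetric] algebra_simps)
  also have "\<dots> = nv_coupling y k j * (?a $ j - ?a $ k)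
      + (\<Sum>l\<in>UNIV - {j, k}. nv_coupling y k l * (?a $ l - ?a $ k))"
    by (subst sum_UNIV_two[OF assms(2)]) simp
  also have "(\<Sum>l\<in>UNIV - {j, k}. nv_coupling y k l * (?a $ l - ?a $ k))
      = (\<Sum>l\<in>UNIV - {j, k}. nv_coupling y k l * (fcoef (fst y) j k - fcoef (fst y) j l))"
    using assms(2) by (intro sum.cong refl) (auto simp: partial_p_nv_ham[OF assms(1)])
  also have "?a $ j - ?a $ k = snd y $ j - pole_sum (fst y) j + fcoef (fst y) j k"
    using assms(2) by (simp add: partial_p_nv_ham[OF assms(1)])
  finally show ?thesis .
qed

lemma poisson_nv_ham:
  assumes y: "y \<in> phase_space" and "j \<noteq> k"
  shows "poisson (nv_ham j) (nv_ham k) y = (fcoef (fst y) j k)\<^sup>2 * (nv_ham k y - nv_ham j y)"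
proof -
  define x p where "x = fst y" and "p = snd y"
  define f F where "f = fcoef x j k" and "F = pole_sum x"
  define T S where "T = (\<lambda>j. \<Sum>l\<in>UNIV. p $ l * fcoef x j l)" and "S = (\<lambda>j. \<Sum>l\<in>UNIV. (fcoef x j l)\<^sup>2)"
  let ?A = "UNIV - {j, k}"
  let ?d = "\<lambda>l. fcoef x j l - fcoef x k l"
  have x: "x \<in> chamber" using y by (auto simp: phase_space_def x_def)
  have fkj: "fcoef x k j = - f"
    unfolding f_def by (rule fcoef_antisym)
  have d: "(\<Sum>l\<in>?A. ?d l) = F j - F k - 2 * f"
    using sum_fcoef_diff[OF \<open>j \<noteq> k\<close>, of x] by (simp add: f_def F_def)
  have e: "(\<Sum>l\<in>?A. p $ l * ?d l) = T j - T k - (p $ j + p $ k) * f"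
    unfolding T_def sum_subtractf[symmetric] sum_UNIV_two[OF \<open>j \<noteq> k\<close>]
    by (simp add: fkj f_def[symmetric] sum_subtractf algebra_simps)
  have s: "(\<Sum>l\<in>?A. (fcoef x j l)\<^sup>2 - (fcoef x k l)\<^sup>2) = S j - S k"
    unfolding S_def sum_subtractf[symmetric] sum_UNIV_two[OF \<open>j \<noteq> k\<close>]
    by (simp add: fkj f_def[symmetric] sum_subtractf)
  \<comment> \<open>With \<open>g\<close> and \<open>h\<close> as below,
    \<open>g h = f (h - g)\<close> collapses both \<open>h^2 (f - g)\<close> and
    \<open>- g^2 (- f - h)\<close> to \<open>f g h\<close>. A second use of the relation extracts
    the factor \<open>f^2\<close>, leaving terms that are summed by \<open>d\<close>,
    \<open>e\<close> and \<open>s\<close>.\<close>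
  have triple: "nv_coupling y k l * (fcoef x j k - fcoef x j l) - nv_coupling y j l * (fcoef x k j - fcoef x k l)
      = f\<^sup>2 / 2 * ((p $ j + p $ k - 2 * F j - 2 * F k) * ?d l + 2 * (p $ l * ?d l)
         + 6 * ((fcoef x j l)\<^sup>2 - (fcoef x k l)\<^sup>2))"
    if "l \<in> ?A" for l
  proof -
    define g h where "g = fcoef x j l" and "h = fcoef x k l"
    have ne: "j \<noteq> l" "k \<noteq> l" using that by auto
    have rel: "g * h = f * h - f * g"
      using fcoef_triple[OF x \<open>j \<noteq> k\<close> ne] by (simp add: g_def h_def f_def algebra_simps)
    have "h * h * (f - g) = f * (g * h)" "g * g * (- f - h) = - (f * (g * h))"
      using rel by algebra+
    then have "(h * h * (f - g)) / 2 * a - (g * g * (- f - h)) / 2 * b = f * (g * h) / 2 * (a + b)" for a b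
      by (simp add: field_simps)
    then have key: "h\<^sup>2 / 2 * a * (f - g) - g\<^sup>2 / 2 * b * (- f - h) = - (f\<^sup>2 / 2) * ((g - h) * (a + b))" for a b
      unfolding rel by (simp add: power2_eq_square field_simps)
    show ?thesis
      unfolding nv_coupling_def x_def[symmetric] p_def[symmetric] F_def[symmetric] f_def[symmetric] fkj
        g_def[symmetric] h_def[symmetric] key
      by (simp add: power2_eq_square algebra_simps)
  qed
  have "poisson (nv_ham j) (nv_ham k) y
      = (\<Sum>l\<in>UNIV. partial_p (nv_ham j) l y * partial_x (nv_ham k) l y)
      - (\<Sum>l\<in>UNIV. partial_p (nv_ham k) l y * partial_x (nv_ham j) l y)"
    by (simp add: poisson_def sum_subtractf mult.commute)
  also have "\<dots> = nv_coupling y k j * (p $ j - F j + f) - nv_coupling y j k * (p $ k - F k - f)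
      + (\<Sum>l\<in>?A. nv_coupling y k l * (fcoef x j k - fcoef x j l) - nv_coupling y j l * (fcoef x k j - fcoef x k l))"
    unfolding sum_partial_x_nv_ham[OF y \<open>j \<noteq> k\<close>] sum_partial_x_nv_ham[OF y \<open>j \<noteq> k\<close>[symmetric]]
      x_def[symmetric] p_def[symmetric] F_def[symmetric] fkj
    by (simp add: sum_subtractf f_def insert_commute)
  also have "(\<Sum>l\<in>?A. nv_coupling y k l * (fcoef x j k - fcoef x j l) - nv_coupling y j l * (fcoef x k j - fcoef x k l))
      = f\<^sup>2 / 2 * ((p $ j + p $ k - 2 * F j - 2 * F k) * (F j - F k - 2 * f)
         + 2 * (T j - T k - (p $ j + p $ k) * f) + 6 * (S j - S k))"
    unfolding d[symmetric] e[symmetric] s[symmetric] sum_distrib_left sum.distrib[symmetric]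
    by (rule sum.cong[OF refl triple])
  finally have 1: "poisson (nv_ham j) (nv_ham k) y = nv_coupling y k j * (p $ j - F j + f) - nv_coupling y j k * (p $ k - F k - f)
      + f\<^sup>2 / 2 * ((p $ j + p $ k - 2 * F j - 2 * F k) * (F j - F k - 2 * f)
         + 2 * (T j - T k - (p $ j + p $ k) * f) + 6 * (S j - S k))" .
  have H: "nv_ham i y = 1 / 2 * (p $ i)\<^sup>2 - (p $ i * F i + T i) + (F i)\<^sup>2 - 3 * S i" for i
    by (simp add: nv_ham_alt x_def p_def F_def T_def S_def pole_sum_def distrib_right sum.distrib sum_distrib_left)
  show ?thesis
    unfolding 1 H nv_coupling_def x_def[symmetric] p_def[symmetric] F_def[symmetric] f_def[symmetric] fkj
    by (simp add: power2_eq_square field_simps)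
qed

text \<open>The bracket of the fields is the field of the Poisson bracket. Differentiating the
  factor \<open>f^2\<close> contributes nothing on a level set, where the two Hamiltonians agree, so
  a combination of the two fields remains.\<close>

lemma lie_bracket_nv_ham:
  assumes "y \<in> level_set c" "j \<noteq> k"
  shows "lie_bracket (ham_field (nv_ham j)) (ham_field (nv_ham k)) y
    = (fcoef (fst y) j k)\<^sup>2 *\<^sub>R (ham_field (nv_ham k) y - ham_field (nv_ham j) y)"
proof -
  have y: "y \<in> phase_space" and H: "nv_ham i y = c" for i
    using assms(1) by (auto simp: level_set_def)
  note D = has_derivative_nv_ham[OF y]
  have f: "((\<lambda>y. (fcoef (fst y) j k)\<^sup>2) has_derivative f') (at y)"
    if "f' = (\<lambda>u. 2 * (- (fcoef (fst y) j k)\<^sup>2 / 2 * (fst u $ j - fst u $ k)) * fcoef (fst y) j k)" for f'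
    unfolding that by (rule derivative_eq_intros y refl)+ simp
  have "((\<lambda>y. (fcoef (fst y) j k)\<^sup>2 * (nv_ham k y - nv_ham j y)) has_derivative
      (\<lambda>u. (fcoef (fst y) j k)\<^sup>2 * (nv_grad k y u - nv_grad j y u))) (at y)"
    by (rule has_derivative_eq_rhs[OF has_derivative_mult[OF f[OF refl] has_derivative_diff[OF D D]]])
      (simp add: H)
  then have P: "(poisson (nv_ham j) (nv_ham k) has_derivative
      (\<lambda>u. (fcoef (fst y) j k)\<^sup>2 * (nv_grad k y u - nv_grad j y u))) (at y)"
    by (rule has_derivative_transform_within_open[OF _ open_phase_space y])
      (simp add: poisson_nv_ham[OF _ assms(2)])
  have "lie_bracket (ham_field (nv_ham j)) (ham_field (nv_ham k)) y = ham_field (poisson (nv_ham j) (nv_ham k)) y"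
    by (rule lie_bracket_ham_field[OF open_phase_space y has_derivative_nv_ham has_derivative_nv_ham
          has_derivative_nv_grad[OF y] has_derivative_nv_grad[OF y] nv_hess_sym nv_hess_sym])
  then show ?thesis
    unfolding ham_field_eq[OF P] ham_field_eq[OF D]
    by (simp add: prod_eq_iff vec_eq_iff algebra_simps)
qed

section \<open>Invariance of the level sets under the flows\<close>

lemma linear_ode_zero:
  fixes D a :: "real \<Rightarrow> real"
  assumes I: "is_interval I" "t0 \<in> I" "t \<in> I"
    and D: "\<And>s. s \<in> I \<Longrightarrow> (D has_real_derivative a s * D s) (at s within I)"
    and a: "continuous_on I a" and "D t0 = 0"
  shows "D t = 0"
proof -
  define l u where "l = min t0 t" and "u = max t0 t"
  have "l \<in> I" "u \<in> I"
    using I by (simp_all add: l_def u_def min_def max_def)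
  then have sub: "{l..u} \<subseteq> I"
    using I(1) unfolding is_interval_1 atLeastAtMost_iff subset_iff by blast
  then have "continuous_on {l..u} a"
    using a continuous_on_subset by blast
  then obtain g where g: "\<And>s. s \<in> {l..u} \<Longrightarrow> (g has_vector_derivative a s) (at s within {l..u})"
    using antiderivative_continuous by blast
  \<comment> \<open>Multiplication by the integrating factor \<open>exp (- g)\<close> makes the
    solution constant on the compact interval between \<open>t0\<close> and
    \<open>t\<close>.\<close>
  have "((\<lambda>s. D s * exp (- g s)) has_real_derivative 0) (at s within {l..u})" if s: "s \<in> {l..u}" for s
  proof -
    have 1: "(D has_real_derivative a s * D s) (at s within {l..u})"
      using D sub s by (meson DERIV_subset subsetD)
    have 2: "(g has_real_derivative a s) (at s within {l..u})"
      using g[OF s] by (simp add: has_real_derivative_iff_has_vector_derivative)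
    show ?thesis
      by (rule derivative_eq_intros 1 2 refl)+ (simp add: algebra_simps)
  qed
  then have "\<exists>C. \<forall>s\<in>{l..u}. D s * exp (- g s) = C"
    by (intro has_field_derivative_zero_constant convex_real_interval)
  then obtain C where "\<And>s. s \<in> {l..u} \<Longrightarrow> D s * exp (- g s) = C"
    by blast
  moreover have "t0 \<in> {l..u}" "t \<in> {l..u}"
    by (auto simp: l_def u_def)
  ultimately show ?thesis
    using \<open>D t0 = 0\<close> by (metis exp_not_eq_zero mult_eq_0_iff)
qed

lemma level_set_invariant:
  fixes \<gamma> :: "real \<Rightarrow> 'n::{finite,linorder} phase"
  assumes I: "is_interval I" "t0 \<in> I" and \<gamma>: "\<gamma> ` I \<subseteq> phase_space"
    and curve: "integral_curve (ham_field (nv_ham j)) I \<gamma>" and "\<gamma> t0 \<in> level_set c"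
  shows "\<gamma> ` I \<subseteq> level_set c"
proof -
  have d: "(\<gamma> has_derivative (\<lambda>s. s *\<^sub>R ham_field (nv_ham j) (\<gamma> t))) (at t within I)" if "t \<in> I" for t
    using curve that by (auto simp: integral_curve_def has_vector_derivative_def)
  have H: "((\<lambda>t. nv_ham k (\<gamma> t)) has_real_derivative poisson (nv_ham j) (nv_ham k) (\<gamma> t)) (at t within I)"
    if "t \<in> I" for k t
  proof -
    have ps: "\<gamma> t \<in> phase_space" using \<gamma> that by auto
    note D = has_derivative_nv_ham[OF ps]
    have "linear (nv_grad k (\<gamma> t))"
      using D has_derivative_linear by blast
    moreover have "((\<lambda>t. nv_ham k (\<gamma> t)) has_derivative (\<lambda>s. nv_grad k (\<gamma> t) (s *\<^sub>R ham_field (nv_ham j) (\<gamma> t)))) (at t within I)"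
      by (rule has_derivative_compose[OF d[OF that] D])
    ultimately show ?thesis
      unfolding poisson_eq(1)[OF D D] has_field_derivative_def
      by (simp add: linear_scale mult.commute[of _ "nv_grad _ _ _"] mult_commute_abs)
  qed
  \<comment> \<open>Conservation of \<open>nv_ham j\<close> along its own flow, as its bracket with
    itself vanishes.\<close>
  have Hj: "nv_ham j (\<gamma> t) = c" if "t \<in> I" for t
  proof -
    have "((\<lambda>t. nv_ham j (\<gamma> t)) has_real_derivative 0) (at s within I)" if "s \<in> I" for s
      using H[OF that, of j] by (simp add: poisson_def mult.commute)
    then have "\<exists>C. \<forall>s\<in>I. nv_ham j (\<gamma> s) = C"
      using I(1) by (intro has_field_derivative_zero_constant) (simp_all add: is_interval_convex_1)
    then obtain C where "\<And>s. s \<in> I \<Longrightarrow> nv_ham j (\<gamma> s) = C"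
      by blast
    then show ?thesis
      using that I(2) \<open>\<gamma> t0 \<in> level_set c\<close> by (auto simp: level_set_def)
  qed
  have "nv_ham k (\<gamma> t) = c" if "t \<in> I" for k t
  proof (cases "k = j")
    case False
    have "nv_ham k (\<gamma> t) - c = 0"
    proof (rule linear_ode_zero[OF I that])
      \<comment> \<open>Because \<open>nv_ham j\<close> equals \<open>c\<close> along the curve, the
        bracket relation becomes a homogeneous linear equation for
        \<open>nv_ham k - c\<close>.\<close>
      show "((\<lambda>t. nv_ham k (\<gamma> t) - c) has_real_derivative
          (fcoef (fst (\<gamma> s)) j k)\<^sup>2 * (nv_ham k (\<gamma> s) - c)) (at s within I)" if "s \<in> I" for s
      proof -
        have "\<gamma> s \<in> phase_space" using \<gamma> that by auto
        then show ?thesis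
          using DERIV_diff[OF H[OF that, of k] DERIV_const[of c]] False
          by (simp add: poisson_nv_ham Hj[OF that])
      qed
      show "continuous_on I (\<lambda>s. (fcoef (fst (\<gamma> s)) j k)\<^sup>2)"
        unfolding continuous_on_eq_continuous_within
      proof (intro ballI continuous_power)
        fix s assume s: "s \<in> I"
        have "fst (\<gamma> s) \<in> chamber"
          using \<gamma> s by (auto simp: phase_space_def)
        from has_derivative_fcoef[OF has_derivative_fst[OF d[OF s]] this]
        show "continuous (at s within I) (\<lambda>s. fcoef (fst (\<gamma> s)) j k)"
          by (rule has_derivative_continuous)
      qed
      show "nv_ham k (\<gamma> t0) - c = 0"
        using \<open>\<gamma> t0 \<in> level_set c\<close> by (simp add: level_set_def)
    qed
    then show ?thesis by simp
  qed (simp add: Hj that)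
  then show ?thesis
    using \<gamma> by (auto simp: level_set_def)
qed

section \<open>Polynomials with prescribed logarithmic derivatives at the nodes\<close>

definition log_deriv_polys :: "('n::finite \<Rightarrow> real) \<Rightarrow> ('n \<Rightarrow> real) \<Rightarrow> real poly set" where
  "log_deriv_polys z r = {y. \<forall>j. poly (pderiv y) (z j) = r j * poly y (z j)}"

text \<open>The Fuchsian equation has exponents 0 and 2 at \<open>z j\<close>. These equations say
  that the solution starting with \<open>1 + r j (X - z j)\<close> meets no logarithmic obstruction
  at second order.\<close>

definition residue_eqs :: "('n::finite \<Rightarrow> real) \<Rightarrow> ('n \<Rightarrow> real) \<Rightarrow> bool" where
  "residue_eqs z r \<longleftrightarrow> (\<forall>j. (r j)\<^sup>2 = (\<Sum>k\<in>UNIV - {j}. (r j - r k) / (z j - z k)))"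

text \<open>On \<open>log_deriv_polys z r\<close> this is the operator \<open>y'' - (W' / W) y' + (\<Sum>j. r j / (X - z j)) y\<close>: the poles of
  the last two terms cancel, so each quotient \<open>p / (X - z j)\<close> may be replaced by its polynomial part.\<close>
definition oper :: "('n::finite \<Rightarrow> real) \<Rightarrow> ('n \<Rightarrow> real) \<Rightarrow> real poly \<Rightarrow> real poly" where
  "oper z r y = pderiv (pderiv y) - (\<Sum>j\<in>UNIV. synthetic_div (pderiv y) (z j))
     + (\<Sum>j\<in>UNIV. smult (r j) (synthetic_div y (z j)))"

text \<open>The coefficient of \<open>X\<close> to the power \<open>i - 2\<close> in the Laurent expansion at infinity of the differential
  operator applied to \<open>y\<close>, for \<open>degree y \<le> D\<close>; it is meaningful for \<open>i = 0, 1\<close> too.\<close>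
definition oper_coeff :: "('n::finite \<Rightarrow> real) \<Rightarrow> ('n \<Rightarrow> real) \<Rightarrow> nat \<Rightarrow> real poly \<Rightarrow> nat \<Rightarrow> real" where
  "oper_coeff z r D y i = real i * (real i - 1) * coeff y i
     - (\<Sum>l=i..D. real l * coeff y l * (\<Sum>j\<in>UNIV. z j ^ (l - i)))
     + (\<Sum>l=i-1..D. coeff y l * (\<Sum>j\<in>UNIV. r j * z j ^ (Suc l - i)))"

section \<open>The operator evaluated at the nodes and on coefficients\<close>

lemma synthetic_div_eval:
  fixes p :: "real poly"
  shows "(a - c) * poly (synthetic_div p c) a = poly p a - poly p c"
  using arg_cong[OF synthetic_div_correct'[of c p], of "\<lambda>q. poly q a"] by (simp add: algebra_simps)

lemma synthetic_div_eval_same: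
  fixes p :: "real poly"
  shows "poly (synthetic_div p c) c = poly (pderiv p) c"
proof -
  have "poly (pderiv ([:- c, 1:] * q + [:k:])) c = poly q c" for q k
    by (simp add: pderiv_add pderiv_mult pderiv_pCons del: mult_pCons_left)
  from this[of "synthetic_div p c" "poly p c"] show ?thesis
    by (simp only: synthetic_div_correct')
qed

lemma poly_eq_sum_atMost:
  fixes p :: "real poly"
  assumes "degree p \<le> D"
  shows "poly p a = (\<Sum>l\<le>D. coeff p l * a ^ l)"
  unfolding poly_altdef using assms
  by (intro sum.mono_neutral_left) (auto simp: coeff_eq_0)

lemma coeff_synthetic_div:
  fixes p :: "real poly"
  assumes "degree p \<le> D"
  shows "coeff (synthetic_div p c) i = (\<Sum>l=Suc i..D. coeff p l * c ^ (l - Suc i))"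
  using assms
proof (induction p arbitrary: i D)
  case (pCons a p)
  show ?case
  proof (cases D)
    case 0
    with pCons have "p = 0" by (auto split: if_splits)
    with 0 show ?thesis by simp
  next
    case (Suc D')
    then have D': "degree p \<le> D'"
      using pCons.prems by (auto split: if_splits)
    show ?thesis
    proof (cases i)
      case 0
      have "coeff (synthetic_div (pCons a p) c) i = (\<Sum>l=0..D'. coeff p l * c ^ l)"
        using poly_eq_sum_atMost[OF D', of c] by (simp add: 0 atLeast0AtMost)
      also have "\<dots> = (\<Sum>l=Suc 0..Suc D'. coeff (pCons a p) l * c ^ (l - Suc 0))"
        unfolding sum.shift_bounds_cl_Suc_ivl by simp
      finally show ?thesis by (simp add: 0 Suc)
    next
      case (Suc i')
      then show ?thesis
        unfolding \<open>D = Suc D'\<close> sum.shift_bounds_cl_Suc_ivl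
        using pCons.IH[OF D'] by simp
    qed
  qed
qed simp

lemma poly_eq_0_of_nodes:
  fixes p :: "real poly" and z :: "'n::finite \<Rightarrow> real"
  assumes "inj z" and nodes: "\<And>j. poly p (z j) = 0" and coeffs: "\<And>m. m \<ge> CARD('n) \<Longrightarrow> coeff p m = 0"
  shows "p = 0"
proof (rule ccontr)
  assume "p \<noteq> 0"
  have "card (range z) \<le> card {a. poly p a = 0}"
    using nodes \<open>p \<noteq> 0\<close> by (intro card_mono poly_roots_finite) auto
  also have "\<dots> \<le> degree p"
    using \<open>p \<noteq> 0\<close> by (rule card_poly_roots_bound)
  finally have "CARD('n) \<le> degree p"
    using \<open>inj z\<close> by (simp add: card_image)
  then show False
    using coeffs[of "degree p"] \<open>p \<noteq> 0\<close> by simp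
qed

text \<open>The quotient by \<open>X - z j\<close> takes the value of a derivative at
  \<open>z j\<close>, so \<open>y''\<close> cancels and \<open>r j y'\<close> appears. The other
  quotients combine to \<open>- y (r j - r k) / (z j - z k)\<close>; by the residue equations the
  total is \<open>r j (y' - r j y)\<close>, which vanishes at \<open>z j\<close>.\<close>

lemma poly_oper_node:
  assumes "inj z" "residue_eqs z r" "y \<in> log_deriv_polys z r"
  shows "poly (oper z r y) (z j) = 0"
proof -
  have V: "poly (pderiv y) (z k) = r k * poly y (z k)" for k
    using assms(3) by (simp add: log_deriv_polys_def)
  have term1: "- poly (synthetic_div (pderiv y) (z k)) (z j) + r k * poly (synthetic_div y (z k)) (z j)
      = - (poly y (z j) * ((r j - r k) / (z j - z k)))" if "k \<in> UNIV - {j}" for k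
  proof -
    have ne: "z j - z k \<noteq> 0" using that \<open>inj z\<close> by (auto simp: inj_def)
    have sd: "poly (synthetic_div p (z k)) (z j) = (poly p (z j) - poly p (z k)) / (z j - z k)" for p
      using synthetic_div_eval[of "z j" "z k" p] ne by (simp add: field_simps)
    have "- ((A * Y - B * Z) / d) + B * ((Y - Z) / d) = - (Y * ((A - B) / d))" for A B Y Z d :: real
      by (simp add: diff_divide_distrib algebra_simps)
    then show ?thesis unfolding sd V .
  qed
  have "poly (oper z r y) (z j) = poly (pderiv (pderiv y)) (z j)
      + (\<Sum>k\<in>UNIV. - poly (synthetic_div (pderiv y) (z k)) (z j) + r k * poly (synthetic_div y (z k)) (z j))"
    by (simp add: oper_def poly_sum sum_negf sum.distrib sum_subtractf)
  also have "\<dots> = r j * poly (pderiv y) (z j)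
      + (\<Sum>k\<in>UNIV - {j}. - poly (synthetic_div (pderiv y) (z k)) (z j) + r k * poly (synthetic_div y (z k)) (z j))"
    by (simp add: sum.remove[of UNIV j] synthetic_div_eval_same)
  also have "(\<Sum>k\<in>UNIV - {j}. - poly (synthetic_div (pderiv y) (z k)) (z j) + r k * poly (synthetic_div y (z k)) (z j))
      = (\<Sum>k\<in>UNIV - {j}. - (poly y (z j) * ((r j - r k) / (z j - z k))))"
    by (rule sum.cong[OF refl term1])
  also have "r j * poly (pderiv y) (z j) + \<dots> = r j * poly (pderiv y) (z j) - poly y (z j) * (\<Sum>k\<in>UNIV - {j}. (r j - r k) / (z j - z k))"
    by (simp add: sum_negf sum_distrib_left)
  also have "(\<Sum>k\<in>UNIV - {j}. (r j - r k) / (z j - z k)) = (r j)\<^sup>2"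
    using assms(2) by (simp add: residue_eqs_def)
  finally show ?thesis
    by (simp add: V power2_eq_square)
qed

lemma coeff_oper:
  assumes "degree y \<le> D"
  shows "coeff (oper z r y) m = oper_coeff z r D y (Suc (Suc m))"
proof -
  have d: "degree (pderiv y) \<le> D"
    using assms by (simp add: degree_pderiv)
  have "(\<Sum>l=Suc m..D. coeff (pderiv y) l * c ^ (l - Suc m))
      = (\<Sum>l=Suc (Suc m)..D. real l * coeff y l * c ^ (l - Suc (Suc m)))" for c
  proof -
    have "(\<Sum>l=Suc m..D. coeff (pderiv y) l * c ^ (l - Suc m))
      = (\<Sum>l=Suc (Suc m)..Suc D. real l * coeff y l * c ^ (l - Suc (Suc m)))"
      unfolding sum.shift_bounds_cl_Suc_ivl[of _ "Suc m"] by (simp add: coeff_pderiv)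
    also have "\<dots> = (\<Sum>l=Suc (Suc m)..D. real l * coeff y l * c ^ (l - Suc (Suc m)))"
      using assms by (intro sum.mono_neutral_right) (auto simp: coeff_eq_0)
    finally show ?thesis .
  qed
  then have 1: "(\<Sum>j\<in>UNIV. coeff (synthetic_div (pderiv y) (z j)) m)
      = (\<Sum>l=Suc (Suc m)..D. real l * coeff y l * (\<Sum>j\<in>UNIV. z j ^ (l - Suc (Suc m))))"
    unfolding coeff_synthetic_div[OF d] sum_distrib_left by (subst sum.swap) simp
  have 2: "(\<Sum>j\<in>UNIV. r j * coeff (synthetic_div y (z j)) m)
      = (\<Sum>l=Suc m..D. coeff y l * (\<Sum>j\<in>UNIV. r j * z j ^ (l - Suc m)))"
    unfolding coeff_synthetic_div[OF assms] sum_distrib_left by (subst sum.swap) (simp add: mult.left_commute)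
  show ?thesis
    using 1 2 by (simp add: oper_def oper_coeff_def coeff_sum coeff_pderiv)
qed

text \<open>From \<open>i = 2\<close> on these are coefficients of \<open>oper z r y\<close>. For
  \<open>i = 0\<close> and \<open>i = 1\<close> they are sums over the nodes of
  \<open>r j y - y'\<close>, weighted by \<open>z j\<close> and by 1, and vanish by the conditions
  at the nodes.\<close>

lemma oper_coeff_zero:
  assumes y: "y \<in> log_deriv_polys z r" and D: "degree y \<le> D" and "oper z r y = 0"
  shows "oper_coeff z r D y i = 0"
proof -
  have V: "poly (pderiv y) (z k) = r k * poly y (z k)" for k
    using y by (simp add: log_deriv_polys_def)
  have py: "poly y c = (\<Sum>l=0..D. coeff y l * c ^ l)" for c
    using poly_eq_sum_atMost[OF D] by (simp add: atLeast0AtMost)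
  have "poly (pderiv y) c * c = poly (pCons 0 (pderiv y)) c" for c
    by simp
  also have "\<dots> c = (\<Sum>l\<le>D. coeff (pCons 0 (pderiv y)) l * c ^ l)" for c
    using D by (intro poly_eq_sum_atMost degree_le)
      (auto simp: coeff_pCons coeff_pderiv coeff_eq_0 split: nat.split)
  also have "\<dots> c = (\<Sum>l=0..D. real l * coeff y l * c ^ l)" for c
    unfolding atLeast0AtMost
    by (intro sum.cong refl) (simp add: coeff_pCons coeff_pderiv split: nat.split)
  finally have py'c: "poly (pderiv y) c * c = (\<Sum>l=0..D. real l * coeff y l * c ^ l)" for c .
  have py': "poly (pderiv y) c = (\<Sum>l=1..D. real l * coeff y l * c ^ (l - 1))" for c
  proof -
    have "poly (pderiv y) c = (\<Sum>l\<le>D. coeff (pderiv y) l * c ^ l)"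
      using D by (intro poly_eq_sum_atMost) (simp add: degree_pderiv)
    also have "\<dots> = (\<Sum>l=Suc 0..Suc D. real l * coeff y l * c ^ (l - 1))"
      unfolding sum.shift_bounds_cl_Suc_ivl by (simp add: coeff_pderiv atLeast0AtMost)
    also have "\<dots> = (\<Sum>l=1..D. real l * coeff y l * c ^ (l - 1))"
      using D by (intro sum.mono_neutral_right) (auto simp: coeff_eq_0)
    finally show ?thesis .
  qed
  consider "i = 0" | "i = 1" | m where "i = Suc (Suc m)"
    by (metis One_nat_def not0_implies_Suc)
  then show ?thesis
  proof cases
    case 1
    have "oper_coeff z r D y i = - (\<Sum>j\<in>UNIV. poly (pderiv y) (z j) * z j) + (\<Sum>j\<in>UNIV. r j * z j * poly y (z j))"
      unfolding py'c py sum_distrib_left oper_coeff_def 1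
      by (subst (2 4) sum.swap) (simp add: mult.commute mult.left_commute)
    also have "\<dots> = 0"
      by (simp add: V mult.commute mult.left_commute)
    finally show ?thesis .
  next
    case 2
    have "oper_coeff z r D y i = - (\<Sum>j\<in>UNIV. poly (pderiv y) (z j)) + (\<Sum>j\<in>UNIV. r j * poly y (z j))"
      unfolding py' py sum_distrib_left oper_coeff_def 2
      by (subst (2 4) sum.swap) (simp add: mult.commute mult.left_commute)
    also have "\<dots> = 0"
      by (simp add: V)
    finally show ?thesis .
  next
    case 3
    then show ?thesis
      using coeff_oper[OF D, of z r m] assms(3) by simp
  qed
qed

text \<open>The image vanishes at all nodes, so it remains to bound its degree by
  \<open>CARD('n) - 1\<close>. The only coefficient that could break the bound comes from degree
  \<open>Suc CARD('n)\<close>, and it is multiplied by the sum of the \<open>r j\<close>.\<close>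

lemma oper_eq_zero:
  fixes z r :: "'n::finite \<Rightarrow> real"
  assumes "inj z" "residue_eqs z r" "y \<in> log_deriv_polys z r" "degree y \<le> D"
    and D: "D \<le> CARD('n) \<or> D = Suc CARD('n) \<and> sum r UNIV = 0"
  shows "oper z r y = 0"
proof (rule poly_eq_0_of_nodes[OF assms(1) poly_oper_node[OF assms(1-3)]])
  fix m assume "CARD('n) \<le> m"
  then have "coeff y (Suc (Suc m)) = 0"
    using assms(4) D by (intro coeff_eq_0) auto
  moreover have "(\<Sum>l=Suc m..D. coeff y l * (\<Sum>j\<in>UNIV. r j * z j ^ (l - Suc m))) = 0"
  proof (cases "D = Suc m")
    case True
    with D \<open>CARD('n) \<le> m\<close> show ?thesis by auto
  next
    case False
    with D \<open>CARD('n) \<le> m\<close> have "D < Suc m" by auto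
    then show ?thesis by simp
  qed
  moreover have "D < Suc (Suc m)"
    using D \<open>CARD('n) \<le> m\<close> by auto
  ultimately show "coeff (oper z r y) m = 0"
    unfolding coeff_oper[OF assms(4)] oper_coeff_def by simp
qed

text \<open>At the index one above the degree, the Laurent coefficient consists of the leading
  coefficient times the sum of the residues.\<close>

lemma sum_residues_zero:
  fixes z r :: "'n::finite \<Rightarrow> real"
  assumes "inj z" "residue_eqs z r" "y \<in> log_deriv_polys z r" "y \<noteq> 0" "degree y \<le> CARD('n)"
  shows "sum r UNIV = 0"
proof -
  have "oper_coeff z r (degree y) y (Suc (degree y)) = 0"
    using assms by (intro oper_coeff_zero oper_eq_zero) auto
  then show ?thesis
    using \<open>y \<noteq> 0\<close> by (simp add: oper_coeff_def coeff_eq_0)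
qed

text \<open>The indicial equation at infinity, read off at the index equal to the degree. The
  contribution of the next lower coefficient carries the sum of the residues; in degree 0 truncated
  subtraction leaves no such term.\<close>

lemma indicial_eq:
  fixes z r :: "'n::finite \<Rightarrow> real" and a :: real
  assumes "y \<in> log_deriv_polys z r" "y \<noteq> 0" "oper z r y = 0" "sum r UNIV = 0"
  defines "a \<equiv> real (degree y)"
  shows "a * (a - 1) - CARD('n) * a + (\<Sum>j\<in>UNIV. r j * z j) = 0"
proof -
  let ?d = "degree y"
  have "(\<Sum>l=?d - 1..?d. coeff y l * (\<Sum>j\<in>UNIV. r j * z j ^ (Suc l - ?d)))
      = lead_coeff y * (\<Sum>j\<in>UNIV. r j * z j)"
  proof (cases ?d)
    case (Suc m)
    then show ?thesis
      using assms(4) by (simp add: sum.atLeast_Suc_atMost)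
  qed simp
  moreover have "oper_coeff z r ?d y ?d = 0"
    using assms by (intro oper_coeff_zero) auto
  ultimately have "lead_coeff y * (a * (a - 1) - CARD('n) * a + (\<Sum>j\<in>UNIV. r j * z j)) = 0"
    by (simp add: oper_coeff_def a_def algebra_simps)
  then show ?thesis
    using \<open>y \<noteq> 0\<close> by simp
qed

section \<open>Existence of fundamental systems of polynomial solutions\<close>

lemma pderiv_sum: "pderiv (sum f A) = (\<Sum>i\<in>A. pderiv (f i))"
  by (induction A rule: infinite_finite_induct) (simp_all add: pderiv_add)

text \<open>Membership imposes \<open>CARD('n)\<close> linear conditions, so more monomials than
  that admit a nontrivial combination. The freedom in \<open>A\<close> allows a chosen power to be
  excluded.\<close>

lemma log_deriv_polys_nonzero:
  fixes z r :: "'n::finite \<Rightarrow> real"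
  assumes "finite A" "card A > CARD('n)"
  shows "\<exists>y\<in>log_deriv_polys z r. y \<noteq> 0 \<and> (\<forall>i. i \<notin> A \<longrightarrow> coeff y i = 0)"
proof -
  define v :: "nat \<Rightarrow> (real, 'n) vec" where
    "v i = (\<chi> j. poly (pderiv (monom 1 i)) (z j) - r j * poly (monom 1 i) (z j))" for i
  \<comment> \<open>Linear dependence concerns the set \<open>v\<close> followed by \<open>A\<close>
    as an image, which forgets repetitions; two equal vectors are treated separately.\<close>
  have "\<exists>c. (\<exists>i\<in>A. c i \<noteq> 0) \<and> (\<Sum>i\<in>A. c i *\<^sub>R v i) = 0"
  proof (cases "inj_on v A")
    case True
    have "dependent (v ` A)"
      using assms True by (intro dependent_biggerset) (simp add: card_image)
    then obtain u where u: "\<exists>w\<in>v ` A. u w \<noteq> 0" "(\<Sum>w\<in>v ` A. u w *\<^sub>R w) = 0"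
      using real_vector.dependent_finite[of "v ` A"] assms(1) by auto
    then show ?thesis
      using True by (intro exI[of _ "\<lambda>i. u (v i)"]) (auto simp: sum.reindex)
  next
    case False
    then obtain i k where ik: "i \<in> A" "k \<in> A" "i \<noteq> k" "v i = v k"
      by (auto simp: inj_on_def)
    let ?c = "\<lambda>l. (if l = i then 1 else 0) - (if l = k then 1 else 0 :: real)"
    have "(\<Sum>l\<in>A. ?c l *\<^sub>R v l) = 0"
      using ik assms(1) by (simp add: scaleR_left_diff_distrib sum_subtractf if_distrib[of "\<lambda>c. c *\<^sub>R _"] cong: if_cong)
    with ik show ?thesis
      by (intro exI[of _ ?c]) auto
  qed
  then obtain c where c: "\<exists>i\<in>A. c i \<noteq> 0" "(\<Sum>i\<in>A. c i *\<^sub>R v i) = 0"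
    by blast
  define y where "y = (\<Sum>i\<in>A. smult (c i) (monom 1 i))"
  have coeff_y: "coeff y i = (if i \<in> A then c i else 0)" for i
    using assms(1) by (simp add: y_def coeff_sum if_distrib cong: if_cong)
  have "poly (pderiv y) (z j) - r j * poly y (z j) = (\<Sum>i\<in>A. c i *\<^sub>R v i) $ j" for j
    by (simp add: y_def v_def pderiv_sum poly_sum pderiv_smult sum_distrib_left sum_subtractf algebra_simps)
  then have "y \<in> log_deriv_polys z r"
    using c(2) by (simp add: log_deriv_polys_def)
  moreover have "y \<noteq> 0"
    using c(1) coeff_y by (metis coeff_0)
  ultimately show ?thesis
    using coeff_y by (intro bexI[of _ y]) auto
qed

lemma smult_log_deriv_polys:
  "y \<in> log_deriv_polys z r \<Longrightarrow> smult c y \<in> log_deriv_polys z r"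
  by (simp add: log_deriv_polys_def pderiv_smult)

text \<open>The exponents \<open>a\<close>, \<open>b\<close> at infinity are the roots of the
  indicial equation, given by their sum and product. The last condition removes the freedom of
  adding a multiple of \<open>y1\<close> to \<open>y2\<close>, so that both polynomials are
  determined by the data.\<close>

definition fund_system ::
    "('n::finite \<Rightarrow> real) \<Rightarrow> ('n \<Rightarrow> real) \<Rightarrow> nat \<Rightarrow> nat \<Rightarrow> real poly \<Rightarrow> real poly \<Rightarrow> bool" where
  "fund_system z r a b y1 y2 \<longleftrightarrow>
     a < b \<and> a + b = Suc CARD('n) \<and> sum r UNIV = 0 \<and> real a * real b = (\<Sum>j\<in>UNIV. r j * z j) \<and>
     y1 \<in> log_deriv_polys z r \<and> y2 \<in> log_deriv_polys z r \<and> oper z r y1 = 0 \<and> oper z r y2 = 0 \<and>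
     degree y1 = a \<and> coeff y1 a = 1 \<and> degree y2 = b \<and> coeff y2 b = 1 \<and> coeff y2 a = 0"

lemma fund_system_exists:
  fixes z r :: "'n::finite \<Rightarrow> real"
  assumes "inj z" "residue_eqs z r"
  shows "\<exists>a b y1 y2. fund_system z r a b y1 y2"
proof -
  let ?n = "CARD('n)"
  let ?P = "\<lambda>d. \<exists>y\<in>log_deriv_polys z r. y \<noteq> 0 \<and> degree y = d"
  obtain y0 where y0: "y0 \<in> log_deriv_polys z r" "y0 \<noteq> 0" "\<And>i. i > ?n \<Longrightarrow> coeff y0 i = 0"
    using log_deriv_polys_nonzero[of "{..?n}" z r] by auto
  then have d0: "degree y0 \<le> ?n"
    by (intro degree_le) auto
  define a where "a = (LEAST d. ?P d)"
  have "?P a" unfolding a_def using y0 by (intro LeastI[of ?P "degree y0"]) auto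
  then obtain p1 where p1: "p1 \<in> log_deriv_polys z r" "p1 \<noteq> 0" "degree p1 = a" by blast
  have least: "a \<le> degree y" if "y \<in> log_deriv_polys z r" "y \<noteq> 0" for y
    unfolding a_def using that by (intro Least_le) blast
  have "a \<le> ?n"
    using least[OF y0(1,2)] d0 by simp
  have r0: "sum r UNIV = 0"
    using sum_residues_zero[OF assms y0(1,2) d0] .
  \<comment> \<open>Leaving out the power \<open>a\<close> still leaves \<open>CARD('n) + 1\<close>
    monomials, and it forces the degree of the second solution to differ from the minimal degree
    \<open>a\<close>.\<close>
  have "finite ({..Suc ?n} - {a})" "card ({..Suc ?n} - {a}) > ?n"
    using \<open>a \<le> ?n\<close> by (simp_all add: card_Diff_singleton_if)
  then obtain p2 where p2: "p2 \<in> log_deriv_polys z r" "p2 \<noteq> 0" "\<And>i. i \<notin> {..Suc ?n} - {a} \<Longrightarrow> coeff p2 i = 0"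
    using log_deriv_polys_nonzero[of "{..Suc ?n} - {a}" z r] by blast
  define b where "b = degree p2"
  have "coeff p2 b \<noteq> 0" using p2(2) by (simp add: b_def)
  then have b: "b \<le> Suc ?n" "b \<noteq> a"
    using p2(3)[of b] by auto
  then have "a < b" using least[OF p2(1,2)] by (simp add: b_def)
  have o: "oper z r p1 = 0" "oper z r p2 = 0"
    using assms p1 p2(1) r0 b(1) \<open>a \<le> ?n\<close>
    by (auto intro!: oper_eq_zero[where D = "Suc ?n"] simp: b_def)
  have "coeff p1 a \<noteq> 0"
    unfolding p1(3)[symmetric] using p1(2) by simp
  define y1 y2 where "y1 = smult (inverse (lead_coeff p1)) p1" and "y2 = smult (inverse (lead_coeff p2)) p2"
  have y12: "y1 \<in> log_deriv_polys z r" "y2 \<in> log_deriv_polys z r" "y1 \<noteq> 0" "y2 \<noteq> 0"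
    using p1 p2 \<open>coeff p1 a \<noteq> 0\<close> by (auto simp: y1_def y2_def smult_log_deriv_polys)
  have deg: "degree y1 = a" "degree y2 = b" "coeff y1 a = 1" "coeff y2 b = 1" "coeff y2 a = 0"
    using p2 \<open>coeff p1 a \<noteq> 0\<close> by (auto simp: y1_def y2_def b_def p1(3))
  have o': "oper z r y1 = 0" "oper z r y2 = 0"
    using assms y12 r0 b(1) \<open>a \<le> ?n\<close> deg
    by (auto intro!: oper_eq_zero[where D = "Suc ?n"])
  have i: "real a * (real a - 1) - ?n * real a + (\<Sum>j\<in>UNIV. r j * z j) = 0"
    "real b * (real b - 1) - ?n * real b + (\<Sum>j\<in>UNIV. r j * z j) = 0"
    using indicial_eq[OF y12(1,3) o'(1) r0] indicial_eq[OF y12(2,4) o'(2) r0] by (simp_all add: deg)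
  \<comment> \<open>Subtracting the two indicial equations gives the sum of the exponents after
    cancelling \<open>b - a\<close>.\<close>
  then have "(real b - real a) * (real a + real b - (?n + 1)) = 0"
    by (simp add: algebra_simps)
  then have ab: "real a + real b = ?n + 1"
    using \<open>a < b\<close> by simp
  moreover have "real a * real b = (\<Sum>j\<in>UNIV. r j * z j)"
  proof -
    have b: "real b = ?n + 1 - real a" using ab by simp
    show ?thesis unfolding b using i(1) by (simp add: algebra_simps)
  qed
  moreover have "a + b = Suc ?n"
    using ab by linarith
  ultimately have "fund_system z r a b y1 y2"
    using \<open>a < b\<close> r0 y12 o' deg by (simp add: fund_system_def)
  then show ?thesis by blast
qed

section \<open>Continuity of the normalized solutions in the data\<close>

lemma oper_coeff_recursion:
  fixes z r :: "'n::finite \<Rightarrow> real"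
  assumes "oper_coeff z r D y i = 0" "sum r UNIV = 0" "i \<le> D"
  shows "(real i * (real i - 1) - CARD('n) * real i + (\<Sum>j\<in>UNIV. r j * z j)) * coeff y i
    = (\<Sum>l=Suc i..D. real l * coeff y l * (\<Sum>j\<in>UNIV. z j ^ (l - i)))
      - (\<Sum>l=Suc i..D. coeff y l * (\<Sum>j\<in>UNIV. r j * z j ^ (Suc l - i)))"
proof -
  \<comment> \<open>The term of index \<open>i - 1\<close> carries the sum of the residues and drops
    out, so coefficient \<open>i\<close> is expressed by higher ones only.\<close>
  have "(\<Sum>l=i-1..D. coeff y l * (\<Sum>j\<in>UNIV. r j * z j ^ (Suc l - i)))
      = (\<Sum>l=i..D. coeff y l * (\<Sum>j\<in>UNIV. r j * z j ^ (Suc l - i)))"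
  proof (cases i)
    case (Suc m)
    then show ?thesis
      using assms(2,3) by (simp add: sum.atLeast_Suc_atMost[of m])
  qed simp
  also have "\<dots> = coeff y i * (\<Sum>j\<in>UNIV. r j * z j)
      + (\<Sum>l=Suc i..D. coeff y l * (\<Sum>j\<in>UNIV. r j * z j ^ (Suc l - i)))"
    using assms(3) by (simp add: sum.atLeast_Suc_atMost[of i])
  finally show ?thesis
    using assms(1,3) by (simp add: oper_coeff_def sum.atLeast_Suc_atMost[of i D] algebra_simps)
qed

text \<open>Away from the two exponents \<open>a\<close>, \<open>b\<close> at infinity the recursion determines the coefficients, so a
  normalization of the coefficients \<open>a\<close> and \<open>b\<close> makes them depend continuously on the data.\<close>
lemma coeff_tendsto:
  fixes z r :: "real \<Rightarrow> 'n::finite \<Rightarrow> real" and Y :: "real \<Rightarrow> real poly"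
  assumes ab: "a + b = Suc CARD('n)"
    and ev: "eventually (\<lambda>s. sum (r s) UNIV = 0 \<and> real a * real b = (\<Sum>j\<in>UNIV. r s j * z s j) \<and>
        (\<forall>i. oper_coeff (z s) (r s) D (Y s) i = 0) \<and> degree (Y s) \<le> D \<and>
        coeff (Y s) a = ca \<and> coeff (Y s) b = cb) (at 0)"
    and at0: "sum (r 0) UNIV = 0" "real a * real b = (\<Sum>j\<in>UNIV. r 0 j * z 0 j)"
        "\<And>i. oper_coeff (z 0) (r 0) D (Y 0) i = 0" "degree (Y 0) \<le> D"
        "coeff (Y 0) a = ca" "coeff (Y 0) b = cb"
    and z: "\<And>j. (\<lambda>s. z s j) \<midarrow>0\<rightarrow> z 0 j" and r: "\<And>j. (\<lambda>s. r s j) \<midarrow>0\<rightarrow> r 0 j"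
  shows "(\<lambda>s. coeff (Y s) i) \<midarrow>0\<rightarrow> coeff (Y 0) i"
proof (induction "Suc D - i" arbitrary: i rule: less_induct)
  case less
  consider "i > D" | "i = a \<or> i = b" | "i \<le> D" "i \<noteq> a" "i \<noteq> b" by linarith
  then show ?case
  proof cases
    case 1
    have "eventually (\<lambda>s. coeff (Y s) i = coeff (Y 0) i) (at 0)"
      using ev by eventually_elim (use 1 at0(4) in \<open>auto simp: coeff_eq_0\<close>)
    then show ?thesis by (rule tendsto_eventually)
  next
    case 2
    have "eventually (\<lambda>s. coeff (Y s) i = coeff (Y 0) i) (at 0)"
      using ev by eventually_elim (use 2 at0(5,6) in auto)
    then show ?thesis by (rule tendsto_eventually)
  next
    case 3
    define c where "c = (real i - real a) * (real i - real b)"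
    have "c \<noteq> 0" using 3 by (simp add: c_def)
    \<comment> \<open>With the sum of the exponents fixed, the indicial polynomial at
      \<open>i\<close> factors as \<open>(i - a) (i - b)\<close>, which is nonzero here.\<close>
    have n: "real CARD('n) = real a + real b - 1"
      using ab by linarith
    define R where "R s = (\<Sum>l=Suc i..D. real l * coeff (Y s) l * (\<Sum>j\<in>UNIV. z s j ^ (l - i)))
      - (\<Sum>l=Suc i..D. coeff (Y s) l * (\<Sum>j\<in>UNIV. r s j * z s j ^ (Suc l - i)))" for s
    have c: "real i * (real i - 1) - CARD('n) * real i + real a * real b = c"
      unfolding c_def n by (simp add: algebra_simps)
    have "R \<midarrow>0\<rightarrow> R 0"
      unfolding R_def using less by (intro tendsto_intros z r) auto
    then have "(\<lambda>s. R s / c) \<midarrow>0\<rightarrow> R 0 / c"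
      using \<open>c \<noteq> 0\<close> by (intro tendsto_intros)
    moreover have "R 0 / c = coeff (Y 0) i"
      using oper_coeff_recursion[OF at0(3,1) 3(1)] \<open>c \<noteq> 0\<close> unfolding at0(2)[symmetric] c
      by (simp add: R_def field_simps)
    moreover have "eventually (\<lambda>s. R s / c = coeff (Y s) i) (at 0)"
      using ev
    proof eventually_elim
      case (elim s)
      then have "(real i * (real i - 1) - CARD('n) * real i + real a * real b) * coeff (Y s) i = R s"
        unfolding R_def using 3(1) by (simp only: oper_coeff_recursion)
      then show ?case
        using \<open>c \<noteq> 0\<close> unfolding c by (simp add: field_simps)
    qed
    ultimately show ?thesis
      by (simp add: tendsto_cong)
  qed
qed

lemma poly_tendsto:
  fixes Y :: "real \<Rightarrow> real poly"
  assumes "\<And>i. (\<lambda>s. coeff (Y s) i) \<midarrow>0\<rightarrow> coeff Y0 i" "eventually (\<lambda>s. degree (Y s) \<le> D) (at 0)"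
    and "degree Y0 \<le> D" and "(\<lambda>s. w s) \<midarrow>0\<rightarrow> c"
  shows "(\<lambda>s. poly (Y s) (w s)) \<midarrow>0\<rightarrow> poly Y0 c"
proof -
  have "(\<lambda>s. \<Sum>i\<le>D. coeff (Y s) i * w s ^ i) \<midarrow>0\<rightarrow> (\<Sum>i\<le>D. coeff Y0 i * c ^ i)"
    by (intro tendsto_intros assms)
  moreover have "eventually (\<lambda>s. (\<Sum>i\<le>D. coeff (Y s) i * w s ^ i) = poly (Y s) (w s)) (at 0)"
    using assms(2) by eventually_elim (simp add: poly_eq_sum_atMost)
  ultimately show ?thesis
    using assms(3) by (simp add: tendsto_cong poly_eq_sum_atMost)
qed

section \<open>The residue pairing\<close>

definition node_deriv :: "('n::finite \<Rightarrow> real) \<Rightarrow> 'n \<Rightarrow> real" where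
  "node_deriv z j = (\<Prod>k\<in>UNIV - {j}. z j - z k)"

lemma node_deriv_nonzero: "inj z \<Longrightarrow> node_deriv z j \<noteq> 0"
  by (auto simp: node_deriv_def inj_def)

definition node_poly :: "('n::finite \<Rightarrow> real) \<Rightarrow> 'n set \<Rightarrow> real poly" where
  "node_poly z A = (\<Prod>k\<in>A. [:- z k, 1:])"

lemma poly_node_poly: "poly (node_poly z A) c = (\<Prod>k\<in>A. c - z k)"
  by (simp add: node_poly_def poly_prod)

lemma poly_node_poly_root: "k \<in> A \<Longrightarrow> poly (node_poly z A) (z k) = (0 :: real)" for z :: "'n::finite \<Rightarrow> real"
  by (auto simp: poly_node_poly)

lemma node_poly_remove: "k \<in> A \<Longrightarrow> node_poly z A = [:- z k, 1:] * node_poly z (A - {k})"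
  unfolding node_poly_def by (rule prod.remove) simp_all

lemma degree_node_poly: "degree (node_poly z A) = card A"
  by (simp add: node_poly_def degree_prod_eq_sum_degree)

lemma lead_coeff_node_poly: "coeff (node_poly z A) (card A) = 1"
  using lead_coeff_prod[of "\<lambda>k. [:- z k, 1:]" A] degree_node_poly[of z A] by (simp add: node_poly_def)

lemma pderiv_node_poly_root:
  assumes "j \<in> A"
  shows "poly (pderiv (node_poly z A)) (z j) = (\<Prod>k\<in>A - {j}. z j - z k)"
  unfolding node_poly_remove[OF assms, of z]
  by (simp add: pderiv_mult pderiv_pCons poly_node_poly del: mult_pCons_left)

text \<open>Differentiate the interpolation formula
  \<open>N = c W + (sum of N(z k) / w k * L k)\<close>, where \<open>L k\<close> is \<open>W\<close>
  without the factor \<open>X - z k\<close>. The multiple of \<open>W\<close> accounts for degree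
  \<open>CARD('n)\<close>, one above what the nodes determine.\<close>

lemma lagrange_pderiv:
  fixes z :: "'n::finite \<Rightarrow> real" and N :: "real poly"
  assumes "inj z" and N: "degree N \<le> CARD('n)"
  defines "w \<equiv> node_deriv z"
  shows "poly (pderiv N) (z j) = poly N (z j) * (\<Sum>k\<in>UNIV - {j}. 1 / (z j - z k))
    + (\<Sum>k\<in>UNIV - {j}. poly N (z k) * w j / (w k * (z j - z k))) + coeff N CARD('n) * w j"
proof -
  define L where "L k = node_poly z (UNIV - {k})" for k
  define W where "W = node_poly z UNIV"
  have w: "w k \<noteq> 0" for k
    unfolding w_def using \<open>inj z\<close> by (rule node_deriv_nonzero)
  have L_same: "poly (L k) (z k) = w k" for k
    by (simp add: L_def poly_node_poly w_def node_deriv_def)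
  have L_other: "poly (L k) (z i) = 0" if "i \<noteq> k" for i k
    using that by (simp add: L_def poly_node_poly_root)
  have dL: "poly (pderiv (L k)) (z j) = w j / (z j - z k)" if "k \<in> UNIV - {j}" for k
  proof -
    have "w j = (z j - z k) * (\<Prod>i\<in>UNIV - {j} - {k}. z j - z i)"
      unfolding w_def node_deriv_def using that by (intro prod.remove) auto
    moreover have "UNIV - {j} - {k} = UNIV - {k} - {j}" by auto
    moreover have "z j - z k \<noteq> 0" using that \<open>inj z\<close> by (auto simp: inj_def)
    ultimately show ?thesis
      using that by (simp add: L_def pderiv_node_poly_root)
  qed
  have dLj: "poly (pderiv (L j)) (z j) = w j * (\<Sum>k\<in>UNIV - {j}. 1 / (z j - z k))"
  proof -
    have "poly (pderiv (L j)) (z j) = (\<Sum>k\<in>UNIV - {j}. \<Prod>i\<in>UNIV - {j} - {k}. z j - z i)"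
      by (simp add: L_def node_poly_def pderiv_prod pderiv_pCons poly_sum poly_prod)
    also have "\<dots> = (\<Sum>k\<in>UNIV - {j}. w j * (1 / (z j - z k)))"
    proof (intro sum.cong refl)
      fix k assume k: "k \<in> UNIV - {j}"
      have "w j = (z j - z k) * (\<Prod>i\<in>UNIV - {j} - {k}. z j - z i)"
        unfolding w_def node_deriv_def using k by (intro prod.remove) auto
      moreover have "z j - z k \<noteq> 0" using k \<open>inj z\<close> by (auto simp: inj_def)
      ultimately show "(\<Prod>i\<in>UNIV - {j} - {k}. z j - z i) = w j * (1 / (z j - z k))"
        by simp
    qed
    finally show ?thesis by (simp add: sum_distrib_left)
  qed
  have dW: "poly (pderiv W) (z j) = w j"
    by (simp add: W_def pderiv_node_poly_root w_def node_deriv_def)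
  define M where "M = smult (coeff N CARD('n)) W + (\<Sum>k\<in>UNIV. smult (poly N (z k) / w k) (L k))"
  have coeff_L: "coeff (L k) m = 0" if "m \<ge> CARD('n)" for k m
  proof (rule coeff_eq_0)
    have "degree (L k) = CARD('n) - 1"
      by (simp add: L_def degree_node_poly card_Diff_singleton_if)
    also have "\<dots> < m"
      by (rule less_le_trans[OF diff_less that]) simp_all
    finally show "degree (L k) < m" .
  qed
  have "N - M = 0"
  proof (rule poly_eq_0_of_nodes[OF \<open>inj z\<close>])
    fix i
    have "poly M (z i) = (\<Sum>k\<in>UNIV. poly N (z k) / w k * poly (L k) (z i))"
      by (simp add: M_def poly_sum W_def poly_node_poly_root)
    also have "\<dots> = poly N (z i)"
      by (simp add: sum.remove[of UNIV i] L_same L_other w)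
    finally show "poly (N - M) (z i) = 0" by simp
  next
    fix m assume m: "CARD('n) \<le> m"
    then have "coeff M m = coeff N CARD('n) * coeff W m"
      by (simp add: M_def coeff_sum coeff_L)
    moreover have "coeff W m = (if m = CARD('n) then 1 else 0)"
      using m lead_coeff_node_poly[of z UNIV] degree_node_poly[of z UNIV]
      by (auto simp: W_def coeff_eq_0)
    ultimately show "coeff (N - M) m = 0"
      using m N by (auto simp: coeff_eq_0)
  qed
  then have "poly (pderiv N) (z j) = poly (pderiv M) (z j)" by simp
  also have "\<dots> = coeff N CARD('n) * w j + (\<Sum>k\<in>UNIV. poly N (z k) / w k * poly (pderiv (L k)) (z j))"
    by (simp add: M_def pderiv_add pderiv_smult pderiv_sum poly_sum dW)
  also have "(\<Sum>k\<in>UNIV. poly N (z k) / w k * poly (pderiv (L k)) (z j))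
      = poly N (z j) * (\<Sum>k\<in>UNIV - {j}. 1 / (z j - z k))
        + (\<Sum>k\<in>UNIV - {j}. poly N (z k) * w j / (w k * (z j - z k)))"
    by (simp add: sum.remove[of UNIV j] dLj dL w mult.commute)
  finally show ?thesis by simp
qed

text \<open>The functional is the sum over the nodes of the residues of \<open>N \<epsilon> / W\<close>, where
  \<open>W\<close> is the node polynomial and \<open>\<epsilon> = (\<Sum>j. e j / (X - z j))\<close>; the
  remaining residue, at infinity, is the product of a leading coefficient with the sum of the \<open>e j\<close>.\<close>
lemma residue_pairing:
  fixes z r e :: "'n::finite \<Rightarrow> real" and N :: "real poly"
  assumes "inj z" and N: "degree N \<le> CARD('n)"
    and e: "\<And>j. 2 * r j * e j = (\<Sum>k\<in>UNIV - {j}. (e j - e k) / (z j - z k))" and e0: "sum e UNIV = 0"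
  shows "(\<Sum>j\<in>UNIV. e j / node_deriv z j * (poly (pderiv N) (z j) - 2 * r j * poly N (z j))) = 0"
proof -
  define w where "w = node_deriv z"
  define \<nu> where "\<nu> j = poly N (z j) / w j" for j
  have w: "w k \<noteq> 0" for k
    unfolding w_def using \<open>inj z\<close> by (rule node_deriv_nonzero)
  have "e j / w j * poly (pderiv N) (z j) = \<nu> j * (\<Sum>k\<in>UNIV - {j}. e j / (z j - z k))
      + (\<Sum>k\<in>UNIV - {j}. e j * \<nu> k / (z j - z k)) + coeff N CARD('n) * e j" for j
    unfolding lagrange_pderiv[OF assms(1,2)] w_def[symmetric] \<nu>_def
    using w[of j] by (simp add: distrib_left sum_distrib_left mult.commute)
  then have "(\<Sum>j\<in>UNIV. e j / w j * poly (pderiv N) (z j))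
      = (\<Sum>j\<in>UNIV. \<nu> j * (\<Sum>k\<in>UNIV - {j}. e j / (z j - z k)))
      + (\<Sum>j\<in>UNIV. \<Sum>k\<in>UNIV - {j}. e j * \<nu> k / (z j - z k)) + coeff N CARD('n) * sum e UNIV"
    by (simp add: sum.distrib sum_distrib_left)
  \<comment> \<open>Exchanging \<open>j\<close> and \<open>k\<close> moves \<open>e\<close> to the
    other index, so that the differences \<open>e j - e k\<close> of the hypothesis appear.\<close>
  also have "(\<Sum>j\<in>UNIV. \<Sum>k\<in>UNIV - {j}. e j * \<nu> k / (z j - z k))
      = (\<Sum>j\<in>UNIV. \<Sum>k\<in>UNIV - {j}. e k * \<nu> j / (z k - z j))"
    by (simp add: sum_diff1 sum_subtractf) (rule sum.swap)
  also have "\<dots> = - (\<Sum>j\<in>UNIV. \<nu> j * (\<Sum>k\<in>UNIV - {j}. e k / (z j - z k)))"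
  proof -
    have "A * B / (u - v) = - (B * (A / (v - u)))" for A B u v :: real
      using minus_divide_right[of "A * B" "v - u"] by (simp add: mult.commute)
    then show ?thesis
      unfolding sum_negf[symmetric] sum_distrib_left by (intro sum.cong refl)
  qed
  finally have "(\<Sum>j\<in>UNIV. e j / w j * poly (pderiv N) (z j))
      = (\<Sum>j\<in>UNIV. \<nu> j * (\<Sum>k\<in>UNIV - {j}. (e j - e k) / (z j - z k)))"
    using e0 by (simp add: diff_divide_distrib sum_subtractf right_diff_distrib)
  also have "\<dots> = (\<Sum>j\<in>UNIV. e j / w j * (2 * r j * poly N (z j)))"
    unfolding e[symmetric] \<nu>_def by (simp add: mult.commute mult.left_commute)
  finally show ?thesis
    unfolding w_def[symmetric] by (simp add: right_diff_distrib sum_subtractf)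
qed

section \<open>The Wronskian and the vanishing of the kernel element\<close>

lemma coeff_mult_top:
  fixes p q :: "real poly"
  assumes "degree p \<le> m" "degree q \<le> l"
  shows "coeff (p * q) (m + l) = coeff p m * coeff q l"
proof -
  have "coeff (p * q) (m + l) = (\<Sum>i\<le>m + l. if i = m then coeff p m * coeff q l else 0)"
    unfolding coeff_mult
  proof (intro sum.cong refl)
    fix i assume "i \<in> {..m + l}"
    consider "i = m" | "i > m" | "i < m" by linarith
    then show "coeff p i * coeff q (m + l - i) = (if i = m then coeff p m * coeff q l else 0)"
      using assms by cases (auto simp: coeff_eq_0)
  qed
  then show ?thesis by simp
qed

text \<open>The Wronskian vanishes at every node because both solutions have the same logarithmic
  derivative there. Comparing degree and leading coefficient, it is \<open>b - a\<close> times the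
  node polynomial, whose roots are simple.\<close>

lemma wronskian_pderiv_nonzero:
  fixes z r :: "'n::finite \<Rightarrow> real"
  assumes "inj z" and fs: "fund_system z r a b y1 y2"
  shows "poly (pderiv (y1 * pderiv y2 - y2 * pderiv y1)) (z k) \<noteq> 0"
proof -
  let ?n = "CARD('n)"
  define Wr where "Wr = y1 * pderiv y2 - y2 * pderiv y1"
  have fs': "a < b" "a + b = Suc ?n" "degree y1 = a" "coeff y1 a = 1" "degree y2 = b" "coeff y2 b = 1"
    "y1 \<in> log_deriv_polys z r" "y2 \<in> log_deriv_polys z r"
    using fs by (auto simp: fund_system_def)
  \<comment> \<open>Multiplication by \<open>X\<close> turns differentiation into
    \<open>coeff y i\<close> times \<open>i\<close>, so top coefficients are computed without a case
    distinction in degree 0.\<close>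
  have shift: "pCons 0 Wr = y1 * pCons 0 (pderiv y2) - y2 * pCons 0 (pderiv y1)"
    by (simp add: Wr_def)
  have cp: "coeff (pCons 0 (pderiv y)) i = real i * coeff y i" for y i
    by (simp add: coeff_pCons coeff_pderiv split: nat.split)
  have deg: "degree (pCons 0 (pderiv y)) \<le> degree y" for y :: "real poly"
    by (intro degree_le) (auto simp: cp coeff_eq_0)
  have coeff_Wr: "coeff Wr m = (if m = ?n then real b - real a else 0)" if "m \<ge> ?n" for m
  proof -
    have "coeff Wr m = coeff (pCons 0 Wr) (Suc m)" by simp
    also have "\<dots> = (if m = ?n then real b - real a else 0)"
    proof (cases "m = ?n")
      case True
      have "coeff (y1 * pCons 0 (pderiv y2)) (a + b) = b"
        using coeff_mult_top[of y1 a "pCons 0 (pderiv y2)" b] deg[of y2] fs' by (simp only: cp)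
      moreover have "coeff (y2 * pCons 0 (pderiv y1)) (b + a) = a"
        using coeff_mult_top[of y2 b "pCons 0 (pderiv y1)" a] deg[of y1] fs' by (simp only: cp)
      ultimately show ?thesis
        using True fs'(2) unfolding shift by (simp add: add.commute)
    next
      case False
      have "degree (y1 * pCons 0 (pderiv y2)) < Suc m" "degree (y2 * pCons 0 (pderiv y1)) < Suc m"
        using degree_mult_le[of y1 "pCons 0 (pderiv y2)"] degree_mult_le[of y2 "pCons 0 (pderiv y1)"]
          deg[of y1] deg[of y2] fs' False that by linarith+
      then show ?thesis
        using False by (simp only: shift coeff_diff coeff_eq_0 if_False diff_self)
    qed
    finally show ?thesis .
  qed
  define W where "W = node_poly z UNIV"
  have "Wr - smult (real b - real a) W = 0"
  proof (rule poly_eq_0_of_nodes[OF \<open>inj z\<close>])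
    fix j
    show "poly (Wr - smult (real b - real a) W) (z j) = 0"
      using fs'(7,8) by (simp add: Wr_def W_def poly_node_poly_root log_deriv_polys_def)
  next
    fix m assume m: "?n \<le> m"
    have "coeff W m = (if m = ?n then 1 else 0)"
      using m lead_coeff_node_poly[of z UNIV] degree_node_poly[of z UNIV]
      by (auto simp: W_def coeff_eq_0)
    then show "coeff (Wr - smult (real b - real a) W) m = 0"
      using m by (simp add: coeff_Wr)
  qed
  then have "Wr = smult (real b - real a) W" by simp
  then have "poly (pderiv Wr) (z k) = (real b - real a) * node_deriv z k"
    by (simp add: pderiv_smult W_def pderiv_node_poly_root node_deriv_def)
  then show ?thesis
    using fs'(1) node_deriv_nonzero[OF \<open>inj z\<close>] by (simp add: Wr_def)
qed

text \<open>The data are moved along the family \<open>z s\<close>, which shifts the \<open>k\<close>-th node by \<open>s\<close>. The polynomials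
  \<open>N s\<close> of the proof form the cross Wronskian of the fundamental systems at \<open>0\<close> and at \<open>s\<close>; dividing
  the pairing of \<open>e\<close> with \<open>N s\<close> by \<open>s\<close> leaves, in the limit, only the contribution of the \<open>k\<close>-th node.\<close>
lemma residue_kernel_trivial:
  fixes z r :: "real \<Rightarrow> 'n::finite \<Rightarrow> real" and e d :: "'n \<Rightarrow> real"
  assumes z: "\<And>s j. z s j = (if j = k then z 0 j + s else z 0 j)"
    and inj0: "inj (z 0)" and eqs0: "residue_eqs (z 0) (r 0)"
    and ev: "eventually (\<lambda>s. inj (z s) \<and> residue_eqs (z s) (r s)) (at 0)"
    and d: "\<And>j. (\<lambda>s. (r s j - r 0 j) / s) \<midarrow>0\<rightarrow> d j"
    and e: "\<And>j. 2 * r 0 j * e j = (\<Sum>i\<in>UNIV - {j}. (e j - e i) / (z 0 j - z 0 i))"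
    and e0: "sum e UNIV = 0"
  shows "e k = 0"
proof -
  let ?n = "CARD('n)"
  define good where "good s = (\<lambda>(a, b, y1, y2). fund_system (z s) (r s) a b y1 y2)" for s
  \<comment> \<open>A choice for all \<open>s\<close> at once; it is meaningful only where the nodes
    are distinct and the residue equations hold.\<close>
  define \<Phi> where "\<Phi> s = (SOME p. good s p)" for s
  define A B Y1 Y2 where "A s = fst (\<Phi> s)" and "B s = fst (snd (\<Phi> s))"
    and "Y1 s = fst (snd (snd (\<Phi> s)))" and "Y2 s = snd (snd (snd (\<Phi> s)))" for s
  have fs: "fund_system (z s) (r s) (A s) (B s) (Y1 s) (Y2 s)"
    if reg: "inj (z s)" "residue_eqs (z s) (r s)" for s
  proof -
    obtain a b y1 y2 where "good s (a, b, y1, y2)"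
      using fund_system_exists[OF reg] by (auto simp: good_def)
    then have "good s (\<Phi> s)"
      unfolding \<Phi>_def by (rule someI)
    then show ?thesis
      by (simp add: good_def A_def B_def Y1_def Y2_def case_prod_beta)
  qed
  define a b y1 y2 where "a = A 0" and "b = B 0" and "y1 = Y1 0" and "y2 = Y2 0"
  have fs0: "fund_system (z 0) (r 0) a b y1 y2"
    using fs[OF inj0 eqs0] by (simp add: a_def b_def y1_def y2_def)
  have rlim: "(\<lambda>s. r s j) \<midarrow>0\<rightarrow> r 0 j" for j
  proof -
    have "(\<lambda>s. (r s j - r 0 j) / s * s + r 0 j) \<midarrow>0\<rightarrow> d j * 0 + r 0 j"
      by (intro tendsto_intros d)
    moreover have "eventually (\<lambda>s. (r s j - r 0 j) / s * s + r 0 j = r s j) (at (0::real))"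
      by (simp add: eventually_at_filter)
    ultimately show ?thesis by (simp add: tendsto_cong)
  qed
  have zlim: "(\<lambda>s. z s j) \<midarrow>0\<rightarrow> z 0 j" for j
  proof (cases "j = k")
    case True
    have "(\<lambda>s. z 0 j + s) \<midarrow>0\<rightarrow> z 0 j + 0" by (intro tendsto_intros)
    then show ?thesis using True by (subst z) simp
  next
    case False
    then show ?thesis by (subst z) simp
  qed
  \<comment> \<open>The product of the exponents is an integer and tends to its value at 0, so it is
    locally constant. Together with the fixed sum and the ordering this fixes both
    exponents.\<close>
  have fs_ev: "eventually (\<lambda>s. fund_system (z s) (r s) a b (Y1 s) (Y2 s)) (at 0)"
  proof -
    have "(\<lambda>s. \<Sum>j\<in>UNIV. r s j * z s j) \<midarrow>0\<rightarrow> (\<Sum>j\<in>UNIV. r 0 j * z 0 j)"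
      by (intro tendsto_intros rlim zlim)
    then have "eventually (\<lambda>s. dist (\<Sum>j\<in>UNIV. r s j * z s j) (\<Sum>j\<in>UNIV. r 0 j * z 0 j) < 1) (at 0)"
      by (rule tendstoD) simp
    then show ?thesis
      using ev
    proof eventually_elim
      case (elim s)
      then have f: "fund_system (z s) (r s) (A s) (B s) (Y1 s) (Y2 s)" using fs by blast
      have s: "A s < B s" "A s + B s = Suc ?n" "real (A s) * real (B s) = (\<Sum>j\<in>UNIV. r s j * z s j)"
        using f by (auto simp: fund_system_def)
      have o: "a < b" "a + b = Suc ?n" "real a * real b = (\<Sum>j\<in>UNIV. r 0 j * z 0 j)"
        using fs0 by (auto simp: fund_system_def)
      have "\<bar>real (A s) * real (B s) - real a * real b\<bar> < 1"
        using elim(1) unfolding s(3) o(3) dist_real_def .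
      then have "\<bar>int (A s * B s) - int (a * b)\<bar> < 1"
        by (simp flip: of_nat_mult)
      then have "int (A s) * int (B s) = int a * int b"
        by simp
      moreover have "int (B s) = int a + int b - int (A s)"
        using s(2) o(2) by linarith
      ultimately have "(int (A s) - int a) * (int (A s) - int b) = 0"
        by (simp add: algebra_simps)
      then have "A s = a \<or> A s = b" by simp
      then have "A s = a" "B s = b" using s o by auto
      with f show ?case by simp
    qed
  qed
  \<comment> \<open>The normalization is 1 at \<open>a\<close> and 0 at \<open>b\<close>, as the
    degree is \<open>a < b\<close>; for \<open>Y2\<close> it is 0 at \<open>a\<close> and 1 at
    \<open>b\<close>.\<close>
  have clim1: "(\<lambda>s. coeff (Y1 s) i) \<midarrow>0\<rightarrow> coeff y1 i" for i
    unfolding y1_def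
  proof (rule coeff_tendsto[where a = a and b = b and z = z and r = r and D = "Suc ?n"
        and ca = 1 and cb = 0])
    show "eventually (\<lambda>s. sum (r s) UNIV = 0 \<and> real a * real b = (\<Sum>j\<in>UNIV. r s j * z s j) \<and>
        (\<forall>i. oper_coeff (z s) (r s) (Suc ?n) (Y1 s) i = 0) \<and> degree (Y1 s) \<le> Suc ?n \<and>
        coeff (Y1 s) a = 1 \<and> coeff (Y1 s) b = 0) (at 0)"
      using fs_ev by eventually_elim (auto simp: fund_system_def coeff_eq_0 intro!: oper_coeff_zero)
  qed (use fs0 rlim zlim in \<open>auto simp: fund_system_def coeff_eq_0 y1_def intro!: oper_coeff_zero\<close>)
  have clim2: "(\<lambda>s. coeff (Y2 s) i) \<midarrow>0\<rightarrow> coeff y2 i" for i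
    unfolding y2_def
  proof (rule coeff_tendsto[where a = a and b = b and z = z and r = r and D = "Suc ?n"
        and ca = 0 and cb = 1])
    show "eventually (\<lambda>s. sum (r s) UNIV = 0 \<and> real a * real b = (\<Sum>j\<in>UNIV. r s j * z s j) \<and>
        (\<forall>i. oper_coeff (z s) (r s) (Suc ?n) (Y2 s) i = 0) \<and> degree (Y2 s) \<le> Suc ?n \<and>
        coeff (Y2 s) a = 0 \<and> coeff (Y2 s) b = 1) (at 0)"
      using fs_ev by eventually_elim (auto simp: fund_system_def coeff_eq_0 intro!: oper_coeff_zero)
  qed (use fs0 rlim zlim in \<open>auto simp: fund_system_def coeff_eq_0 y2_def intro!: oper_coeff_zero\<close>)
  have deg_ev: "eventually (\<lambda>s. degree (Y1 s) \<le> Suc ?n) (at 0)" "eventually (\<lambda>s. degree (Y2 s) \<le> Suc ?n) (at 0)"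
    using fs_ev by (eventually_elim, auto simp: fund_system_def)+
  have deg0: "degree y1 \<le> Suc ?n" "degree y2 \<le> Suc ?n"
    using fs0 by (auto simp: fund_system_def)
  have V0: "poly (pderiv y1) (z 0 j) = r 0 j * poly y1 (z 0 j)" "poly (pderiv y2) (z 0 j) = r 0 j * poly y2 (z 0 j)" for j
    using fs0 by (auto simp: fund_system_def log_deriv_polys_def)
  define c where "c = z 0 k"
  \<comment> \<open>For a solution \<open>Y\<close> at parameter \<open>s\<close>, the polynomial
    \<open>h Y s\<close> vanishes at the shifted node \<open>c + s\<close>, so \<open>h Y s\<close>
    at \<open>c\<close> is \<open>- s * q Y s\<close>. Using the synthetic quotient keeps
    \<open>q\<close> defined at \<open>s = 0\<close>, where it is a derivative.\<close>
  define h where "h Y s = pderiv Y - smult (r s k) Y" for Y s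
  define q where "q Y s = poly (synthetic_div (h Y s) c) (c + s)" for Y s
  define N where "N s = y1 * Y2 s - y2 * Y1 s" for s
  have Nlim: "(\<lambda>s. poly (N s) w) \<midarrow>0\<rightarrow> 0" for w
  proof -
    have "(\<lambda>s. poly (N s) w) \<midarrow>0\<rightarrow> poly y1 w * poly y2 w - poly y2 w * poly y1 w"
      unfolding N_def poly_diff poly_mult
      by (intro tendsto_intros poly_tendsto[OF clim1 deg_ev(1) deg0(1)] poly_tendsto[OF clim2 deg_ev(2) deg0(2)])
    then show ?thesis by simp
  qed
  have qlim: "(\<lambda>s. q (Y s) s) \<midarrow>0\<rightarrow> poly (pderiv (pderiv y)) c - r 0 k * poly (pderiv y) c"
    if Y: "\<And>i. (\<lambda>s. coeff (Y s) i) \<midarrow>0\<rightarrow> coeff y i" "eventually (\<lambda>s. degree (Y s) \<le> Suc ?n) (at 0)" "degree y \<le> Suc ?n"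
    for Y y
  proof -
    have hdeg: "degree (h Y' s) \<le> Suc ?n" if "degree Y' \<le> Suc ?n" for Y' s
      unfolding h_def using that degree_diff_le[of "pderiv Y'" "Suc ?n" "smult (r s k) Y'"]
      by (simp add: degree_pderiv)
    have hc: "(\<lambda>s. coeff (h (Y s) s) i) \<midarrow>0\<rightarrow> coeff (h y 0) i" for i
      unfolding h_def coeff_diff coeff_smult coeff_pderiv by (intro tendsto_intros Y rlim)
    have "(\<lambda>s. coeff (synthetic_div (h (Y s) s) c) i) \<midarrow>0\<rightarrow> coeff (synthetic_div (h y 0) c) i" for i
    proof -
      have "(\<lambda>s. \<Sum>l=Suc i..Suc ?n. coeff (h (Y s) s) l * c ^ (l - Suc i))
          \<midarrow>0\<rightarrow> coeff (synthetic_div (h y 0) c) i"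
        unfolding coeff_synthetic_div[OF hdeg[OF Y(3)]] by (intro tendsto_intros hc)
      moreover have "eventually (\<lambda>s. (\<Sum>l=Suc i..Suc ?n. coeff (h (Y s) s) l * c ^ (l - Suc i))
          = coeff (synthetic_div (h (Y s) s) c) i) (at 0)"
        using Y(2) by eventually_elim (simp add: coeff_synthetic_div[OF hdeg])
      ultimately show ?thesis by (simp add: tendsto_cong)
    qed
    moreover have "eventually (\<lambda>s. degree (synthetic_div (h (Y s) s) c) \<le> Suc ?n) (at 0)"
      using Y(2) by eventually_elim (use hdeg in \<open>simp add: degree_synthetic_div le_diff_conv le_SucI\<close>)
    moreover have "degree (synthetic_div (h y 0) c) \<le> Suc ?n"
      using hdeg[OF Y(3)] by (simp add: degree_synthetic_div le_diff_conv le_SucI)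
    moreover have "(\<lambda>s. c + s) \<midarrow>0\<rightarrow> c"
      using tendsto_add[OF tendsto_const tendsto_ident_at, of c 0 UNIV] by simp
    ultimately have "(\<lambda>s. q (Y s) s) \<midarrow>0\<rightarrow> poly (synthetic_div (h y 0) c) c"
      unfolding q_def by (rule poly_tendsto)
    then show ?thesis
      by (simp add: synthetic_div_eval_same h_def pderiv_diff pderiv_smult)
  qed
  define g where "g s j = poly (pderiv (N s)) (z 0 j) - 2 * r 0 j * poly (N s) (z 0 j)" for s j
  \<comment> \<open>In each product one factor has logarithmic derivative \<open>r 0 j\<close> and
    the other \<open>r s j\<close>, so subtracting \<open>2 * r 0 j\<close> leaves their difference.
    The correction at \<open>j = k\<close> arises because that node has moved.\<close>
  have g: "g s j = (r s j - r 0 j) * poly (N s) (z 0 j)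
      - (if j = k then s * (poly y1 c * q (Y2 s) s - poly y2 c * q (Y1 s) s) else 0)"
    if f: "fund_system (z s) (r s) a b (Y1 s) (Y2 s)" for s j
  proof -
    have V: "poly (pderiv (Y1 s)) (z s i) = r s i * poly (Y1 s) (z s i)"
      "poly (pderiv (Y2 s)) (z s i) = r s i * poly (Y2 s) (z s i)" for i
      using f by (auto simp: fund_system_def log_deriv_polys_def)
    have dev: "poly (pderiv Y) (z 0 j) = r s j * poly Y (z 0 j) - (if j = k then s * q Y s else 0)"
      if Y: "\<And>i. poly (pderiv Y) (z s i) = r s i * poly Y (z s i)" for Y
    proof (cases "j = k")
      case True
      have "z s k = c + s" using z[of s k] by (simp add: c_def)
      then have "poly (h Y s) (c + s) = 0"
        using Y[of k] by (simp add: h_def)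
      then have "s * q Y s = - poly (h Y s) c"
        using synthetic_div_eval[of "c + s" c "h Y s"] by (simp add: q_def)
      then show ?thesis
        using True by (simp add: h_def c_def)
    next
      case False
      then show ?thesis using Y[of j] z[of s j] by simp
    qed
    show ?thesis
      unfolding g_def N_def by (simp add: pderiv_diff pderiv_mult V0 dev[OF V(1)] dev[OF V(2)] c_def algebra_simps)
  qed
  \<comment> \<open>Both products in \<open>N s\<close> are monic of degree
    \<open>CARD('n) + 1\<close>; their leading terms cancel, which gives the degree bound of
    \<open>residue_pairing\<close>.\<close>
  have pair: "(\<Sum>j\<in>UNIV. e j / node_deriv (z 0) j * g s j) = 0"
    if f: "fund_system (z s) (r s) a b (Y1 s) (Y2 s)" for s
    unfolding g_def
  proof (rule residue_pairing[OF inj0 _ e e0])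
    have ab: "a + b = Suc ?n" using fs0 by (simp add: fund_system_def)
    have dg: "degree y1 = a" "degree (Y1 s) = a" "degree y2 = b" "degree (Y2 s) = b"
      "coeff y1 a = 1" "coeff (Y1 s) a = 1" "coeff y2 b = 1" "coeff (Y2 s) b = 1"
      using fs0 f by (simp_all add: fund_system_def)
    have 1: "degree (y1 * Y2 s) \<le> Suc ?n" "degree (y2 * Y1 s) \<le> Suc ?n"
      using degree_mult_le[of y1 "Y2 s"] degree_mult_le[of y2 "Y1 s"] dg ab by simp_all
    have 2: "coeff (y1 * Y2 s) (Suc ?n) = 1" "coeff (y2 * Y1 s) (Suc ?n) = 1"
      using coeff_mult_top[of y1 a "Y2 s" b] coeff_mult_top[of y2 b "Y1 s" a] dg ab
      by (simp_all add: add.commute)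
    show "degree (N s) \<le> ?n"
    proof (rule degree_le, intro allI impI)
      fix i assume "?n < i"
      then consider "i = Suc ?n" | "i > Suc ?n" by linarith
      then show "coeff (N s) i = 0"
        using 1 2 by cases (simp_all add: N_def coeff_eq_0)
    qed
  qed
  define X where "X s = (\<Sum>j\<in>UNIV. e j / node_deriv (z 0) j * ((r s j - r 0 j) / s * poly (N s) (z 0 j)))
      - e k / node_deriv (z 0) k * (poly y1 c * q (Y2 s) s - poly y2 c * q (Y1 s) s)" for s
  have "eventually (\<lambda>s. X s = 0) (at 0)"
    using fs_ev eventually_at_filter[of "\<lambda>s. s \<noteq> 0" "0::real" UNIV, simplified]
  proof eventually_elim
    case (elim s)
    have "X s = (\<Sum>j\<in>UNIV. e j / node_deriv (z 0) j * (g s j / s))"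
    proof -
      have "e j / node_deriv (z 0) j * (g s j / s) = e j / node_deriv (z 0) j * ((r s j - r 0 j) / s * poly (N s) (z 0 j))
        - (if j = k then e k / node_deriv (z 0) k * (poly y1 c * q (Y2 s) s - poly y2 c * q (Y1 s) s) else 0)" for j
      proof -
        have F: "E * ((R * M - s * T) / s) = E * (R / s * M) - E * T" for E R M T
          using elim(2) by (simp add: diff_divide_distrib right_diff_distrib)
        show ?thesis
        proof (cases "j = k")
          case True
          show ?thesis by (simp only: True g[OF elim(1)] simp_thms if_True F)
        qed (simp add: g[OF elim(1)])
      qed
      then show ?thesis by (simp add: X_def sum_subtractf)
    qed
    also have "\<dots> = (\<Sum>j\<in>UNIV. e j / node_deriv (z 0) j * g s j) / s"
      by (simp add: sum_divide_distrib)
    finally show ?case using pair elim by simp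
  qed
  moreover have "X \<midarrow>0\<rightarrow> (\<Sum>j\<in>UNIV. e j / node_deriv (z 0) j * (d j * 0))
      - e k / node_deriv (z 0) k * (poly y1 c * (poly (pderiv (pderiv y2)) c - r 0 k * poly (pderiv y2) c)
          - poly y2 c * (poly (pderiv (pderiv y1)) c - r 0 k * poly (pderiv y1) c))"
    unfolding X_def
    by (intro tendsto_intros d Nlim qlim clim1 clim2 deg_ev deg0)
  \<comment> \<open>The terms with \<open>r 0 k\<close> multiply the Wronskian, which vanishes at
    the node; the derivative of the Wronskian remains.\<close>
  moreover have "poly y1 c * (poly (pderiv (pderiv y2)) c - r 0 k * poly (pderiv y2) c)
          - poly y2 c * (poly (pderiv (pderiv y1)) c - r 0 k * poly (pderiv y1) c)
      = poly (pderiv (y1 * pderiv y2 - y2 * pderiv y1)) (z 0 k)"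
    by (simp add: pderiv_diff pderiv_mult c_def V0 algebra_simps)
  ultimately have "X \<midarrow>0\<rightarrow> - (e k / node_deriv (z 0) k * poly (pderiv (y1 * pderiv y2 - y2 * pderiv y1)) (z 0 k))"
    "X \<midarrow>0\<rightarrow> 0"
    by (simp_all add: tendsto_eventually)
  then have "e k / node_deriv (z 0) k * poly (pderiv (y1 * pderiv y2 - y2 * pderiv y1)) (z 0 k) = 0"
    using LIM_unique by fastforce
  then show ?thesis
    using wronskian_pderiv_nonzero[OF inj0 fs0] node_deriv_nonzero[OF inj0] by simp
qed

section \<open>The flow of the null vector equations\<close>

definition residue :: "('n::{finite,linorder} \<Rightarrow> (real, 'n) vec \<Rightarrow> real) \<Rightarrow> 'n \<Rightarrow> (real, 'n) vec \<Rightarrow> real" where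
  "residue U j x = (pole_sum x j - U j x) / 4"

lemma sum_over_nodes:
  "(\<Sum>k\<in>UNIV - {j}. g k / (x $ j - x $ k)) = (\<Sum>k\<in>UNIV. fcoef x j k * g k) / 2"
proof -
  have "(\<Sum>k\<in>UNIV. fcoef x j k * g k) = (\<Sum>k\<in>UNIV - {j}. fcoef x j k * g k)"
    by (rule sum_Diff_refl[symmetric]) simp
  also have "\<dots> = (\<Sum>k\<in>UNIV - {j}. 2 * (g k / (x $ j - x $ k)))"
    by (intro sum.cong refl) (simp add: fcoef_def)
  also have "\<dots> = 2 * (\<Sum>k\<in>UNIV - {j}. g k / (x $ j - x $ k))"
    by (rule sum_distrib_left[symmetric])
  finally show ?thesis by simp
qed

lemma pole_sum_eq: "(\<Sum>k\<in>UNIV - {j}. 2 / (x $ j - x $ k)) = pole_sum x j"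
  unfolding sum_over_nodes by (simp add: pole_sum_def flip: sum_distrib_right)

lemma momentum_eq: "momentum U x $ j = 2 * pole_sum x j - 4 * residue U j x"
  by (simp add: momentum_def pole_sum_eq residue_def field_simps)

lemma momentum_alt: "momentum U x $ j = U j x + pole_sum x j"
  by (simp add: momentum_def pole_sum_eq)

lemma null_vector_alt:
  assumes "null_vector_eqs U" "x \<in> chamber"
  shows "1 / 2 * (U j x)\<^sup>2 - (\<Sum>k\<in>UNIV. fcoef x j k * U k x) - 3 / 2 * (\<Sum>k\<in>UNIV. (fcoef x j k)\<^sup>2) = 0"
proof -
  have "(\<Sum>k\<in>UNIV - {j}. 2 / (x $ k - x $ j) * U k x) = (\<Sum>k\<in>UNIV - {j}. - (fcoef x j k * U k x))"
  proof (intro sum.cong refl)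
    fix k assume "k \<in> UNIV - {j}"
    then have "2 / (x $ k - x $ j) = - fcoef x j k"
      using fcoef_antisym[of x k j] by (simp add: fcoef_def)
    then show "2 / (x $ k - x $ j) * U k x = - (fcoef x j k * U k x)"
      by simp
  qed
  also have "\<dots> = - (\<Sum>k\<in>UNIV. fcoef x j k * U k x)"
    by (simp add: sum_negf sum_Diff_refl)
  finally have 1: "(\<Sum>k\<in>UNIV - {j}. 2 / (x $ k - x $ j) * U k x) = - (\<Sum>k\<in>UNIV. fcoef x j k * U k x)" .
  have "(\<Sum>k\<in>UNIV - {j}. 6 / (x $ j - x $ k)\<^sup>2) = (\<Sum>k\<in>UNIV - {j}. 3 / 2 * (fcoef x j k)\<^sup>2)"
    by (intro sum.cong refl) (auto simp: fcoef_def power_divide)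
  also have "\<dots> = 3 / 2 * (\<Sum>k\<in>UNIV. (fcoef x j k)\<^sup>2)"
    unfolding sum_distrib_left by (rule sum_Diff_refl) simp
  finally have 2: "(\<Sum>k\<in>UNIV - {j}. 6 / (x $ j - x $ k)\<^sup>2) = 3 / 2 * (\<Sum>k\<in>UNIV. (fcoef x j k)\<^sup>2)" .
  have "1 / 2 * (U j x)\<^sup>2 + (\<Sum>k\<in>UNIV - {j}. 2 / (x $ k - x $ j) * U k x)
      - (\<Sum>k\<in>UNIV - {j}. 6 / (x $ j - x $ k)\<^sup>2) = 0"
    using assms unfolding null_vector_eqs_def by blast
  then show ?thesis
    unfolding 1 2 by simp
qed

text \<open>Substitute \<open>U = pole_sum - 4 * residue\<close> into the null vector equations. By
  \<open>sum_fcoef_pole_sum\<close> the terms free of residues cancel, and what is left is divisible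
  by 8.\<close>

lemma residue_square:
  assumes "null_vector_eqs U" "x \<in> chamber"
  shows "(residue U j x)\<^sup>2 = (\<Sum>k\<in>UNIV. fcoef x j k * (residue U j x - residue U k x)) / 2"
proof -
  define r where "r k = residue U k x" for k
  have U: "U k x = pole_sum x k - 4 * r k" for k
    by (simp add: r_def residue_def field_simps)
  have "(\<Sum>k\<in>UNIV. fcoef x j k * U k x)
      = (\<Sum>k\<in>UNIV. fcoef x j k * pole_sum x k) - 4 * (\<Sum>k\<in>UNIV. fcoef x j k * r k)"
    by (simp add: U right_diff_distrib sum_subtractf sum_distrib_left mult.left_commute)
  moreover have "(\<Sum>k\<in>UNIV. fcoef x j k * (r j - r k)) = pole_sum x j * r j - (\<Sum>k\<in>UNIV. fcoef x j k * r k)"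
    by (simp add: right_diff_distrib sum_subtractf pole_sum_def sum_distrib_right)
  ultimately show ?thesis
    using null_vector_alt[OF assms, of j] unfolding sum_fcoef_pole_sum[OF assms(2)] r_def[symmetric] U[of j]
    by (simp add: power2_eq_square algebra_simps)
qed

lemma residue_eqs_residue:
  assumes "null_vector_eqs U" "x \<in> chamber"
  shows "residue_eqs (($) x) (\<lambda>j. residue U j x)"
  unfolding residue_eqs_def sum_over_nodes using residue_square[OF assms] by blast

text \<open>After substituting \<open>p = U + pole_sum\<close>, the products of \<open>U j\<close>
  and \<open>pole_sum x j\<close> cancel, and \<open>sum_fcoef_pole_sum\<close> reduces the
  remainder to the null vector equation.\<close>

lemma nv_ham_momentum:
  assumes "null_vector_eqs U" "x \<in> chamber"
  shows "nv_ham j (x, momentum U x) = 0"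
proof -
  have "(\<Sum>k\<in>UNIV. (momentum U x $ j + momentum U x $ k) * fcoef x j k)
      = (U j x + pole_sum x j) * pole_sum x j + (\<Sum>k\<in>UNIV. fcoef x j k * U k x)
        + (\<Sum>k\<in>UNIV. fcoef x j k * pole_sum x k)"
    by (simp add: momentum_alt distrib_left distrib_right sum.distrib pole_sum_def sum_distrib_left mult.commute)
  then show ?thesis
    using null_vector_alt[OF assms, of j]
    unfolding nv_ham_alt fst_conv snd_conv sum_fcoef_pole_sum[OF assms(2)] momentum_alt[of U x j]
    by (simp add: power2_eq_square algebra_simps)
qed

section \<open>The force on the residues and the linearized equations\<close>

lemma inj_chamber: "x \<in> chamber \<Longrightarrow> inj (($) x)"
  by (meson chamber_distinct injI)

text \<open>Triples of distinct indices cancel, since the symmetrized term is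
  \<open>f_jk + f_jl\<close> times the three-term expression. The cases \<open>l = j\<close> and
  \<open>l = k\<close> give one cube each.\<close>

lemma sum_fcoef_square_pole_sum:
  assumes "x \<in> chamber"
  shows "(\<Sum>k\<in>UNIV. (fcoef x j k)\<^sup>2 * (pole_sum x j - pole_sum x k)) = 2 * (\<Sum>k\<in>UNIV. fcoef x j k ^ 3)"
proof -
  let ?t = "\<lambda>k l. (fcoef x j k)\<^sup>2 * (fcoef x j l - fcoef x k l)"
  have "(\<Sum>k\<in>UNIV. (fcoef x j k)\<^sup>2 * (pole_sum x j - pole_sum x k)) = (\<Sum>k\<in>UNIV. \<Sum>l\<in>UNIV. ?t k l)"
    by (simp add: pole_sum_def sum_subtractf sum_distrib_left flip: sum_distrib_left)
  also have "\<dots> = (\<Sum>k\<in>UNIV - {j}. ?t k j + ?t k k) + (\<Sum>k\<in>UNIV - {j}. \<Sum>l\<in>UNIV - {j, k}. ?t k l)"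
    by (rule sum_pairs_split) simp
  also have "(\<Sum>k\<in>UNIV - {j}. \<Sum>l\<in>UNIV - {j, k}. ?t k l) = 0"
  proof (rule sum_distinct_antisym_zero)
    fix k l assume kl: "k \<noteq> j" "l \<noteq> j" "k \<noteq> l"
    define A B C where "A = fcoef x j k" and "B = fcoef x j l" and "C = fcoef x k l"
    have rel: "A * B - A * C + B * C = 0"
      unfolding A_def B_def C_def using kl by (intro fcoef_triple[OF assms]) auto
    have "A\<^sup>2 * (B - C) + B\<^sup>2 * (A + C) = (A * B - A * C + B * C) * (A + B)"
      by (simp add: power2_eq_square algebra_simps)
    then show "?t k l + ?t l k = 0"
      using rel fcoef_antisym[of x l k] by (simp add: A_def B_def C_def)
  qed
  also have "(\<Sum>k\<in>UNIV - {j}. ?t k j + ?t k k) + 0 = (\<Sum>k\<in>UNIV - {j}. 2 * fcoef x j k ^ 3)"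
    unfolding add_0_right
    by (intro sum.cong refl) (simp add: fcoef_antisym[of x _ j] power2_eq_square power3_eq_cube)
  also have "\<dots> = 2 * (\<Sum>k\<in>UNIV. fcoef x j k ^ 3)"
    by (simp add: sum_Diff_refl flip: sum_distrib_left)
  finally show ?thesis .
qed

text \<open>The rate of change of the residues that Newton's equations demand along
  \<open>x' = p\<close>.\<close>

definition residue_force :: "(real, 'n::{finite,linorder}) vec \<Rightarrow> ('n \<Rightarrow> real) \<Rightarrow> 'n \<Rightarrow> real" where
  "residue_force x r j = (\<Sum>k\<in>UNIV. (fcoef x j k)\<^sup>2 * (r j - r k))"

text \<open>The force satisfies what results from differentiating the equations for \<open>r\<close>
  in direction \<open>v\<close>, with \<open>fcoef x j k\<close> changing at rate
  \<open>- f^2 / 2 * (v j - v k)\<close>.\<close>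

lemma residue_force_linearized:
  assumes "x \<in> chamber" and r: "\<And>j. (r j)\<^sup>2 = (\<Sum>k\<in>UNIV. fcoef x j k * (r j - r k)) / 2"
    and v: "\<And>j. v j = 2 * pole_sum x j - 4 * r j"
  defines "R \<equiv> residue_force x r"
  shows "2 * r j * R j = (\<Sum>k\<in>UNIV. - (fcoef x j k)\<^sup>2 / 2 * (v j - v k) * (r j - r k)
      + fcoef x j k * (R j - R k)) / 2"
proof -
  \<comment> \<open>Every difference of squares, pole sums and forces is written as a sum over a
    third index \<open>l\<close>. The square of \<open>r j - r k\<close> enters as
    \<open>2 r j (r j - r k) - (r j^2 - r k^2)\<close>, whence the term
    \<open>2 r j R j\<close>.\<close>
  let ?t = "\<lambda>k l. - (fcoef x j k)\<^sup>2 / 2 * (fcoef x j l * (r j - r l) - fcoef x k l * (r k - r l))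
    - (fcoef x j k)\<^sup>2 / 2 * (fcoef x j l - fcoef x k l) * (r j - r k)
    + fcoef x j k / 2 * ((fcoef x j l)\<^sup>2 * (r j - r l) - (fcoef x k l)\<^sup>2 * (r k - r l))"
  have t: "- (fcoef x j k)\<^sup>2 / 2 * (v j - v k) * (r j - r k) / 2 + fcoef x j k * (R j - R k) / 2
      = 2 * r j * ((fcoef x j k)\<^sup>2 * (r j - r k)) + (\<Sum>l\<in>UNIV. ?t k l)" for k
  proof -
    have "(\<Sum>l\<in>UNIV. ?t k l) = - (fcoef x j k)\<^sup>2 * ((r j)\<^sup>2 - (r k)\<^sup>2)
        - (fcoef x j k)\<^sup>2 / 2 * (pole_sum x j - pole_sum x k) * (r j - r k)
        + fcoef x j k / 2 * (R j - R k)"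
      unfolding r R_def residue_force_def pole_sum_def diff_divide_distrib[symmetric] sum_subtractf[symmetric]
      by (simp only: sum.distrib sum_subtractf sum_distrib_left[symmetric] sum_distrib_right[symmetric])
    then show ?thesis
      unfolding v by (simp add: power2_eq_square field_simps)
  qed
  have "(\<Sum>k\<in>UNIV. \<Sum>l\<in>UNIV. ?t k l)
      = (\<Sum>k\<in>UNIV - {j}. ?t k j + ?t k k) + (\<Sum>k\<in>UNIV - {j}. \<Sum>l\<in>UNIV - {j, k}. ?t k l)"
    by (rule sum_pairs_split) simp
  also have "(\<Sum>k\<in>UNIV - {j}. ?t k j + ?t k k) = 0"
    by (intro sum.neutral ballI) (simp add: fcoef_antisym[of x _ j] power2_eq_square field_simps)
  also have "(\<Sum>k\<in>UNIV - {j}. \<Sum>l\<in>UNIV - {j, k}. ?t k l) = 0"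
  proof (rule sum_distinct_antisym_zero)
    fix k l assume kl: "k \<noteq> j" "l \<noteq> j" "k \<noteq> l"
    define A B C D E where "A = fcoef x j k" and "B = fcoef x j l" and "C = fcoef x k l"
      and "D = r j - r k" and "E = r j - r l"
    have rel: "A * B - A * C + B * C = 0"
      unfolding A_def B_def C_def using kl by (intro fcoef_triple[OF assms(1)]) auto
    have DE: "r k - r l = E - D" "r l - r k = D - E" and C: "fcoef x l k = - C"
      by (simp_all add: D_def E_def C_def fcoef_antisym[of x l k])
    \<comment> \<open>The symmetrized term contains the three-term expression as a factor.\<close>
    have "(- A\<^sup>2 / 2 * (B * E - C * (E - D)) - A\<^sup>2 / 2 * (B - C) * D + A / 2 * (B\<^sup>2 * E - C\<^sup>2 * (E - D)))
      + (- B\<^sup>2 / 2 * (A * D - - C * (D - E)) - B\<^sup>2 / 2 * (A - - C) * E + B / 2 * (A\<^sup>2 * D - (- C)\<^sup>2 * (D - E)))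
      = (A * B - A * C + B * C) * (E * (C - A) - D * (B + C)) / 2"
      by (simp add: power2_eq_square field_simps)
    then show "?t k l + ?t l k = 0"
      unfolding DE C rel by (simp add: A_def B_def C_def D_def E_def)
  qed
  finally have 0: "(\<Sum>k\<in>UNIV. \<Sum>l\<in>UNIV. ?t k l) = 0 + 0" .
  have "(\<Sum>k\<in>UNIV. - (fcoef x j k)\<^sup>2 / 2 * (v j - v k) * (r j - r k) + fcoef x j k * (R j - R k)) / 2
      = (\<Sum>k\<in>UNIV. 2 * r j * ((fcoef x j k)\<^sup>2 * (r j - r k)) + (\<Sum>l\<in>UNIV. ?t k l))"
    unfolding sum_divide_distrib add_divide_distrib by (rule sum.cong[OF refl t])
  also have "\<dots> = (\<Sum>k\<in>UNIV. 2 * r j * ((fcoef x j k)\<^sup>2 * (r j - r k))) + (0 + 0)"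
    unfolding 0[symmetric] by (rule sum.distrib)
  also have "\<dots> = 2 * r j * R j"
    by (simp add: R_def residue_force_def sum_distrib_left)
  finally show ?thesis ..
qed

section \<open>Residues along the flow and Newton's equations\<close>

lemma has_derivative_pole_sum:
  assumes "x \<in> chamber"
  shows "((\<lambda>x. pole_sum x j) has_derivative
      (\<lambda>u. \<Sum>k\<in>UNIV. - (fcoef x j k)\<^sup>2 / 2 * (u $ j - u $ k))) (at x)"
  unfolding pole_sum_def
  by (intro has_derivative_sum has_derivative_fcoef[OF has_derivative_ident assms])

lemma residue_differentiable:
  assumes "smooth_on chamber (U j)" "x \<in> chamber"
  shows "residue U j differentiable at x"
proof -
  have "U j differentiable at x"
    using assms unfolding smooth_on_def by (metis Ck_on.simps(2))
  moreover have "(\<lambda>x. pole_sum x j) differentiable at x"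
    using has_derivative_pole_sum[OF assms(2)] by (auto simp: differentiable_def)
  ultimately show ?thesis
    unfolding residue_def[abs_def] by simp
qed

text \<open>Both sides solve the linearized equations in direction \<open>momentum U x\<close>.
  Their difference \<open>e\<close> is annihilated by \<open>residue_kernel_trivial\<close>, applied
  once for each coordinate axis; differentiability of the residues supplies the limits of difference
  quotients.\<close>

lemma residue_flow:
  fixes U :: "'n::{finite,linorder} \<Rightarrow> (real, 'n) vec \<Rightarrow> real"
  assumes nve: "null_vector_eqs U" and x: "x \<in> chamber"
    and D: "\<And>j. (residue U j has_derivative D j) (at x)"
  shows "D j (momentum U x) = residue_force x (\<lambda>j. residue U j x) j"
proof -
  define v where "v = momentum U x"
  define r where "r j = residue U j x" for j
  define R where "R = residue_force x r"
  define e where "e j = D j v - R j" for j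
  have rsq: "(r j)\<^sup>2 = (\<Sum>k\<in>UNIV. fcoef x j k * (r j - r k)) / 2" for j
    unfolding r_def by (rule residue_square[OF nve x])
  have lin: "2 * r j * D j v = (\<Sum>k\<in>UNIV. - (fcoef x j k)\<^sup>2 / 2 * (v $ j - v $ k) * (r j - r k)
      + fcoef x j k * (D j v - D k v)) / 2" for j
  proof -
    have "((\<lambda>x. (residue U j x)\<^sup>2) has_derivative (\<lambda>u. 2 * D j u * r j)) (at x)"
      by (rule derivative_eq_intros D refl)+ (simp add: r_def)
    moreover have "((\<lambda>x. (\<Sum>k\<in>UNIV. fcoef x j k * (residue U j x - residue U k x)) / 2) has_derivative
        (\<lambda>u. (\<Sum>k\<in>UNIV. fcoef x j k * (D j u - D k u)
          + - (fcoef x j k)\<^sup>2 / 2 * (u $ j - u $ k) * (r j - r k)) / 2)) (at x)"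
      unfolding r_def divide_inverse
      by (intro has_derivative_mult_left has_derivative_sum has_derivative_mult has_derivative_diff D
          has_derivative_fcoef[OF has_derivative_ident x, unfolded divide_inverse])
    then have "((\<lambda>x. (residue U j x)\<^sup>2) has_derivative
        (\<lambda>u. (\<Sum>k\<in>UNIV. fcoef x j k * (D j u - D k u)
          + - (fcoef x j k)\<^sup>2 / 2 * (u $ j - u $ k) * (r j - r k)) / 2)) (at x)"
      by (rule has_derivative_transform_within_open[OF _ open_chamber x]) (simp only: residue_square[OF nve])
    ultimately have "(\<lambda>u. 2 * D j u * r j) = (\<lambda>u. (\<Sum>k\<in>UNIV. fcoef x j k * (D j u - D k u)
          + - (fcoef x j k)\<^sup>2 / 2 * (u $ j - u $ k) * (r j - r k)) / 2)"
      by (rule has_derivative_unique)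
    from fun_cong[OF this, of v] show ?thesis
      by (simp only: mult.assoc mult.commute[of "r j"] add.commute[of "fcoef _ _ _ * _"])
  qed
  have lin_R: "2 * r j * R j = (\<Sum>k\<in>UNIV. - (fcoef x j k)\<^sup>2 / 2 * (v $ j - v $ k) * (r j - r k)
      + fcoef x j k * (R j - R k)) / 2" for j
    unfolding R_def by (rule residue_force_linearized[OF x rsq]) (simp add: v_def r_def momentum_eq)
  have e: "2 * r j * e j = (\<Sum>k\<in>UNIV - {j}. (e j - e k) / (x $ j - x $ k))" for j
  proof -
    have "2 * r j * e j = (\<Sum>k\<in>UNIV. fcoef x j k * (D j v - D k v) - fcoef x j k * (R j - R k)) / 2"
      unfolding e_def right_diff_distrib[of "2 * r j"] lin lin_R diff_divide_distrib[symmetric] sum_subtractf[symmetric]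
      by simp
    also have "\<dots> = (\<Sum>k\<in>UNIV. fcoef x j k * (e j - e k)) / 2"
      by (simp add: e_def algebra_simps)
    finally show ?thesis by (simp only: sum_over_nodes)
  qed
  \<comment> \<open>A fundamental system records that the residues sum to zero; the identity holds
    on the open chamber and can be differentiated.\<close>
  have sum0: "(\<Sum>j\<in>UNIV. residue U j y) = 0" if "y \<in> chamber" for y
    using fund_system_exists[OF inj_chamber[OF that] residue_eqs_residue[OF nve that]]
    by (auto simp: fund_system_def)
  have e0: "sum e UNIV = 0"
  proof -
    have "((\<lambda>y. 0) has_derivative (\<lambda>u. \<Sum>j\<in>UNIV. D j u)) (at x)"
      by (rule has_derivative_transform_within_open[OF has_derivative_sum[OF D] open_chamber x]) (rule sum0)
    then have "(\<lambda>u. \<Sum>j\<in>UNIV. D j u) = (\<lambda>u. 0)"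
      using has_derivative_const has_derivative_unique by blast
    then have "(\<Sum>j\<in>UNIV. D j v) = 0" by meson
    moreover have "sum R UNIV = 0"
      unfolding R_def residue_force_def
    proof (rule sum_antisym_zero)
      show "(fcoef x k l)\<^sup>2 * (r k - r l) + (fcoef x l k)\<^sup>2 * (r l - r k) = 0" for k l
        unfolding fcoef_square_sym[of x l k] by (simp add: algebra_simps)
    qed
    ultimately show ?thesis by (simp add: e_def sum_subtractf)
  qed
  have "e k = 0" for k
  proof (rule residue_kernel_trivial[where z = "\<lambda>s j. (x + s *\<^sub>R axis k 1) $ j"
        and r = "\<lambda>s j. residue U j (x + s *\<^sub>R axis k 1)" and d = "\<lambda>j. D j (axis k 1)"])
    have cont: "((\<lambda>s. x + s *\<^sub>R axis k 1) \<longlongrightarrow> x + 0 *\<^sub>R axis k 1) (at (0::real))"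
      by (intro tendsto_intros)
    then have "eventually (\<lambda>s. x + s *\<^sub>R axis k 1 \<in> chamber) (at (0::real))"
      using x by (intro topological_tendstoD[OF _ open_chamber]) simp_all
    then show "eventually (\<lambda>s. inj (($) (x + s *\<^sub>R axis k 1)) \<and>
        residue_eqs (($) (x + s *\<^sub>R axis k 1)) (\<lambda>j. residue U j (x + s *\<^sub>R axis k 1))) (at (0::real))"
      by eventually_elim (use inj_chamber residue_eqs_residue[OF nve] in blast)
    show "(\<lambda>s. (residue U j (x + s *\<^sub>R axis k 1) - residue U j (x + 0 *\<^sub>R axis k 1)) / s) \<midarrow>0\<rightarrow> D j (axis k 1)" for j
    proof -
      have "((\<lambda>s. x + s *\<^sub>R axis k 1) has_derivative (\<lambda>h. h *\<^sub>R axis k 1)) (at (0::real))"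
        by (auto intro!: derivative_eq_intros)
      moreover have "(residue U j has_derivative D j) (at (x + 0 *\<^sub>R axis k 1))"
        using D by simp
      ultimately have "((\<lambda>s. residue U j (x + s *\<^sub>R axis k 1)) has_derivative (\<lambda>h. D j (h *\<^sub>R axis k 1))) (at (0::real))"
        by (rule has_derivative_compose)
      then have "((\<lambda>s. residue U j (x + s *\<^sub>R axis k 1)) has_real_derivative D j (axis k 1)) (at 0)"
        unfolding has_field_derivative_def
        by (simp add: linear_scale[OF has_derivative_linear[OF D]] mult_commute_abs)
      then show ?thesis
        by (simp add: DERIV_def)
    qed
  qed (use e e0 inj_chamber[OF x] residue_eqs_residue[OF nve x] in \<open>auto simp: axis_def r_def\<close>)
  then show ?thesis
    by (simp add: e_def v_def R_def r_def[abs_def])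
qed

text \<open>In the derivative of \<open>2 * pole_sum - 4 * residue\<close>, the pole sums produce
  the cubes and \<open>4 * residue_force\<close>; the latter cancels against the change of the
  residues from \<open>residue_flow\<close>.\<close>

lemma has_derivative_momentum:
  fixes U :: "'n::{finite,linorder} \<Rightarrow> (real, 'n) vec \<Rightarrow> real"
  assumes nve: "null_vector_eqs U" and smooth: "\<And>j. smooth_on chamber (U j)" and x: "x \<in> chamber"
  obtains M where "(momentum U has_derivative M) (at x)"
    "M (momentum U x) = (\<chi> l. - 4 * (\<Sum>k\<in>UNIV. fcoef x l k ^ 3))"
proof -
  have "\<forall>j. \<exists>D. (residue U j has_derivative D) (at x)"
    using residue_differentiable[OF smooth x] by (auto simp: differentiable_def)
  then obtain D where D: "\<And>j. (residue U j has_derivative D j) (at x)"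
    by metis
  define M where "M u = (\<chi> j. 2 * (\<Sum>k\<in>UNIV. - (fcoef x j k)\<^sup>2 / 2 * (u $ j - u $ k)) - 4 * D j u)" for u
  have "((\<lambda>x. \<chi> j. 2 * pole_sum x j - 4 * residue U j x) has_derivative M) (at x)"
    unfolding M_def
    by (intro has_derivative_vec_lambda has_derivative_diff has_derivative_mult_right
        has_derivative_pole_sum[OF x] D)
  moreover have "momentum U = (\<lambda>x. \<chi> j. 2 * pole_sum x j - 4 * residue U j x)"
    by (simp add: fun_eq_iff vec_eq_iff momentum_eq)
  ultimately have "(momentum U has_derivative M) (at x)"
    by simp
  moreover have "M (momentum U x) $ j = - 4 * (\<Sum>k\<in>UNIV. fcoef x j k ^ 3)" for j
  proof -
    have "(\<Sum>k\<in>UNIV. - (fcoef x j k)\<^sup>2 / 2 * (momentum U x $ j - momentum U x $ k))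
        = (\<Sum>k\<in>UNIV. 2 * ((fcoef x j k)\<^sup>2 * (residue U j x - residue U k x))
            - (fcoef x j k)\<^sup>2 * (pole_sum x j - pole_sum x k))"
      by (intro sum.cong refl) (simp add: momentum_eq field_simps)
    also have "\<dots> = 2 * residue_force x (\<lambda>j. residue U j x) j - 2 * (\<Sum>k\<in>UNIV. fcoef x j k ^ 3)"
      by (simp add: sum_subtractf residue_force_def sum_fcoef_square_pole_sum[OF x] flip: sum_distrib_left)
    finally show ?thesis
      by (simp add: M_def residue_flow[OF nve x D])
  qed
  ultimately show ?thesis
    using that by (simp add: vec_eq_iff)
qed

text \<open>From the Hamiltonian flow one reads off the first component, which is
  \<open>x' = p\<close>. Conversely, the chain rule and \<open>has_derivative_momentum\<close> give
  the equation for the momenta.\<close>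

lemma integral_curve_sle0_iff:
  fixes U :: "'n::{finite,linorder} \<Rightarrow> (real, 'n) vec \<Rightarrow> real"
  assumes nve: "null_vector_eqs U" and smooth: "\<And>j. smooth_on chamber (U j)" and \<gamma>: "\<gamma> ` I \<subseteq> chamber"
  shows "integral_curve (sle0_field U) I \<gamma> \<longleftrightarrow>
    integral_curve (ham_field cm_ham) I (\<lambda>t. (\<gamma> t, momentum U (\<gamma> t)))"
proof -
  have field: "sle0_field U = momentum U"
    by (simp add: fun_eq_iff sle0_field_def momentum_def)
  have ham: "ham_field cm_ham (\<gamma> t, momentum U (\<gamma> t))
      = (momentum U (\<gamma> t), \<chi> l. - 4 * (\<Sum>k\<in>UNIV. fcoef (\<gamma> t) l k ^ 3))" if "t \<in> I" for t
    using \<gamma> that by (subst ham_field_cm_ham) (auto simp: phase_space_def)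
  have "(\<gamma> has_vector_derivative momentum U (\<gamma> t)) (at t within I) \<longleftrightarrow>
    ((\<lambda>t. (\<gamma> t, momentum U (\<gamma> t))) has_vector_derivative
      (momentum U (\<gamma> t), \<chi> l. - 4 * (\<Sum>k\<in>UNIV. fcoef (\<gamma> t) l k ^ 3))) (at t within I)"
    if t: "t \<in> I" for t
  proof
    assume L: "(\<gamma> has_vector_derivative momentum U (\<gamma> t)) (at t within I)"
    have "\<gamma> t \<in> chamber" using \<gamma> t by auto
    then obtain M where M: "(momentum U has_derivative M) (at (\<gamma> t))"
      "M (momentum U (\<gamma> t)) = (\<chi> l. - 4 * (\<Sum>k\<in>UNIV. fcoef (\<gamma> t) l k ^ 3))"
      using has_derivative_momentum[OF nve smooth] by blast
    have "((\<lambda>t. momentum U (\<gamma> t)) has_derivative (\<lambda>s. M (s *\<^sub>R momentum U (\<gamma> t)))) (at t within I)"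
      using L M(1) unfolding has_vector_derivative_def by (rule has_derivative_compose)
    then have "((\<lambda>t. momentum U (\<gamma> t)) has_vector_derivative M (momentum U (\<gamma> t))) (at t within I)"
      unfolding has_vector_derivative_def linear_scale[OF has_derivative_linear[OF M(1)]] .
    from has_vector_derivative_Pair[OF L this]
    show "((\<lambda>t. (\<gamma> t, momentum U (\<gamma> t))) has_vector_derivative
      (momentum U (\<gamma> t), \<chi> l. - 4 * (\<Sum>k\<in>UNIV. fcoef (\<gamma> t) l k ^ 3))) (at t within I)"
      unfolding M(2) .
  next
    assume "((\<lambda>t. (\<gamma> t, momentum U (\<gamma> t))) has_vector_derivative
      (momentum U (\<gamma> t), \<chi> l. - 4 * (\<Sum>k\<in>UNIV. fcoef (\<gamma> t) l k ^ 3))) (at t within I)"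
    from bounded_linear.has_vector_derivative[OF bounded_linear_fst this]
    show "(\<gamma> has_vector_derivative momentum U (\<gamma> t)) (at t within I)"
      by simp
  qed
  then show ?thesis
    by (simp add: integral_curve_def field ham)
qed

theorem theorem1p10:
  shows
    "(\<forall>U :: 'n::{finite,linorder} \<Rightarrow> (real, 'n) vec \<Rightarrow> real.
        (\<forall>j. smooth_on chamber (U j)) \<and> null_vector_eqs U \<longrightarrow>
          (\<forall>I \<gamma>. is_interval I \<and> \<gamma> ` I \<subseteq> chamber \<longrightarrow>
             (integral_curve (sle0_field U) I \<gamma> \<longleftrightarrow>
              integral_curve (ham_field cm_ham) I (\<lambda>t. (\<gamma> t, momentum U (\<gamma> t)))))
        \<and> (\<forall>x\<in>chamber. \<forall>j. nv_ham j (x, momentum U x) = 0)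
        \<and> (\<forall>x\<in>chamber. cm_ham (x, momentum U x) = 0))
     \<and> (\<forall>y\<in>(phase_space :: 'n phase set). (\<Sum>j\<in>UNIV. nv_ham j y) = cm_ham y)
     \<and> (\<forall>y\<in>(phase_space :: 'n phase set). \<forall>j k. j \<noteq> k \<longrightarrow>
          poisson (nv_ham j) (nv_ham k) y = (fcoef (fst y) j k)\<^sup>2 * (nv_ham k y - nv_ham j y))
     \<and> (\<forall>c. \<forall>y\<in>(level_set c :: 'n phase set). \<forall>j k. j \<noteq> k \<longrightarrow>
          poisson (nv_ham j) (nv_ham k) y = 0 \<and>
          lie_bracket (ham_field (nv_ham j)) (ham_field (nv_ham k)) y =
            (fcoef (fst y) j k)\<^sup>2 *\<^sub>R (ham_field (nv_ham k) y - ham_field (nv_ham j) y))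
     \<and> (\<forall>c j I (\<gamma> :: real \<Rightarrow> 'n phase) t0.
          is_interval I \<and> t0 \<in> I \<and> \<gamma> ` I \<subseteq> phase_space \<and> integral_curve (ham_field (nv_ham j)) I \<gamma> \<and>
          \<gamma> t0 \<in> level_set c \<longrightarrow> \<gamma> ` I \<subseteq> level_set c)"
proof (intro conjI allI impI ballI)
  fix U :: "'n \<Rightarrow> (real, 'n) vec \<Rightarrow> real" and I and \<gamma> :: "real \<Rightarrow> (real, 'n) vec"
  assume "(\<forall>j. smooth_on chamber (U j)) \<and> null_vector_eqs U" "is_interval I \<and> \<gamma> ` I \<subseteq> chamber"
  then show "integral_curve (sle0_field U) I \<gamma> \<longleftrightarrow>
      integral_curve (ham_field cm_ham) I (\<lambda>t. (\<gamma> t, momentum U (\<gamma> t)))"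
    by (intro integral_curve_sle0_iff) auto
next
  fix U :: "'n \<Rightarrow> (real, 'n) vec \<Rightarrow> real" and x :: "(real, 'n) vec"
  assume U: "(\<forall>j. smooth_on chamber (U j)) \<and> null_vector_eqs U" and x: "x \<in> chamber"
  then show H: "nv_ham j (x, momentum U x) = 0" for j
    by (intro nv_ham_momentum) auto
  have "(x, momentum U x) \<in> phase_space"
    using x by (simp add: phase_space_def)
  from sum_nv_ham[OF this] show "cm_ham (x, momentum U x) = 0"
    by (simp add: H)
next
  fix c and y :: "'n phase" and j k :: 'n
  assume "y \<in> level_set c" "j \<noteq> k"
  then show "poisson (nv_ham j) (nv_ham k) y = 0"
    by (simp add: level_set_def poisson_nv_ham)
next
  fix c j I t0 and \<gamma> :: "real \<Rightarrow> 'n phase"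
  assume "is_interval I \<and> t0 \<in> I \<and> \<gamma> ` I \<subseteq> phase_space \<and>
    integral_curve (ham_field (nv_ham j)) I \<gamma> \<and> \<gamma> t0 \<in> level_set c"
  then show "\<gamma> ` I \<subseteq> level_set c"
    by (elim conjE) (rule level_set_invariant)
qed (rule sum_nv_ham poisson_nv_ham lie_bracket_nv_ham; assumption)+

end
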